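(* Let $m$ be a positive integer with $\gcd(m,6)=1$ and $m\equiv 3\pmod 4$, and let $e=\frac{3^{\frac{m+3}{2}}+5}{2}$. If $m\not\equiv 0\pmod{13}$, then the ternary cyclic code $\mathcal{C}_{(1,e)}$ has parameters $[3^m-1,\ 3^m-1-2m,\ 4]$ and is optimal.
   Context: Let $m$ be a positive integer, $\mathbb{F}_{3^m}$ the finite field with $3^m$ elements, and $\alpha$ a generator of the multiplicative group $\mathbb{F}_{3^m}^*$. For an integer $i$, $m_{\alpha^i}(x)$ denotes the minimal polynomial of $\alpha^i$ over $\mathbb{F}_3$. An $[n,k,d]$ linear code over $\mathbb{F}_3$ is a $k$-dimensional subspace of $\mathbb{F}_3^n$ with minimum Hamming distance $d$. A ternary cyclic code of length $n$ (with $\gcd(n,3)=1$) is identified with an ideal of $\mathbb{F}_3[x]/(x^n-1)$ via $(c_0,\dots,c_{n-1})\mapsto c_0+c_1x+\cdots+c_{n-1}x^{n-1}$; its generator polynomial is the monic polynomial of least degree generating the ideal. $\mathcal{C}_{(i_1,i_2,\dots,i_t)}$ denotes the ternary cyclic code of length $3^m-1$ with generator polynomial $m_{\alpha^{i_1}}(x)m_{\alpha^{i_2}}(x)\cdots m_{\alpha^{i_t}}(x)$. A ternary $[n,k,d]$ code is optimal (in the standard sense) if no linear code over $\mathbb{F}_3$ of length $n$ and dimension $k$ has minimum distance larger than $d$. *)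

theory Defs
  imports
    "Jordan_Normal_Form.VS_Connect"
    "HOL-Algebra.QuotRing"
    "HOL-Library.Cardinality"
    "HOL-Number_Theory.Cong"
begin

section \<open>Linear codes\<close>

definition linear_code :: "nat \<Rightarrow> 'f::field vec set \<Rightarrow> bool" where
  "linear_code n C \<longleftrightarrow> VectorSpace.subspace class_ring C (module_vec TYPE('f) n)"

definition code_dim :: "nat \<Rightarrow> 'f::field vec set \<Rightarrow> nat" where
  "code_dim n C = vectorspace.dim class_ring ((module_vec TYPE('f) n)\<lparr>carrier := C\<rparr>)"

definition hamming_distance :: "'f vec \<Rightarrow> 'f vec \<Rightarrow> nat" where
  "hamming_distance u v = card {i. i < dim_vec u \<and> u $ i \<noteq> v $ i}"

text \<open>Only meaningful for codes with at least two words: for the zero code this is the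
  unspecified value \<open>Min {}\<close>.\<close>

definition min_distance :: "'f vec set \<Rightarrow> nat" where
  "min_distance C = Min {hamming_distance u v | u v. u \<in> C \<and> v \<in> C \<and> u \<noteq> v}"

definition has_parameters :: "'f::field vec set \<Rightarrow> nat \<Rightarrow> nat \<Rightarrow> nat \<Rightarrow> bool" where
  "has_parameters C n k d \<longleftrightarrow> linear_code n C \<and> code_dim n C = k \<and> min_distance C = d"

definition optimal_code :: "nat \<Rightarrow> 'f::field vec set \<Rightarrow> bool" where
  "optimal_code n C \<longleftrightarrow> linear_code n C \<and>
     (\<forall>D :: 'f vec set. linear_code n D \<and> code_dim n D = code_dim n C
        \<longrightarrow> min_distance D \<le> min_distance C)"

section \<open>Cyclic codes\<close>

definition word_poly :: "'f::zero vec \<Rightarrow> 'f poly" where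
  "word_poly v = Poly (list_of_vec v)"

definition cyclic_modulus :: "nat \<Rightarrow> 'f::field poly set" where
  "cyclic_modulus n = Idl\<^bsub>class_ring\<^esub> {monom 1 n - 1}"

definition cyclic_ring :: "nat \<Rightarrow> 'f::field poly set ring" where
  "cyclic_ring n = class_ring Quot (cyclic_modulus n)"

definition residue_class :: "nat \<Rightarrow> 'f::field poly \<Rightarrow> 'f poly set" where
  "residue_class n p = cyclic_modulus n +>\<^bsub>class_ring\<^esub> p"

definition code_ideal :: "nat \<Rightarrow> 'f::field vec set \<Rightarrow> 'f poly set set" where
  "code_ideal n C = (\<lambda>v. residue_class n (word_poly v)) ` C"

definition cyclic_code :: "nat \<Rightarrow> 'f::field vec set \<Rightarrow> bool" where
  "cyclic_code n C \<longleftrightarrow> C \<subseteq> carrier_vec n \<and> ideal (code_ideal n C) (cyclic_ring n)"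

definition generates_code :: "nat \<Rightarrow> 'f::field vec set \<Rightarrow> 'f poly \<Rightarrow> bool" where
  "generates_code n C g \<longleftrightarrow> code_ideal n C = Idl\<^bsub>cyclic_ring n\<^esub> {residue_class n g}"

definition generator_polynomial :: "nat \<Rightarrow> 'f::field vec set \<Rightarrow> 'f poly \<Rightarrow> bool" where
  "generator_polynomial n C g \<longleftrightarrow> lead_coeff g = 1 \<and> generates_code n C g \<and>
     (\<forall>h. lead_coeff h = 1 \<and> generates_code n C h \<longrightarrow> degree g \<le> degree h)"

text \<open>There is at most one such code. It exists iff \<open>g\<close> is a monic divisor of \<open>x\<^sup>n - 1\<close>
  (for \<open>n > 0\<close>); for other \<open>g\<close> the value is unspecified.\<close>

definition cyclic_code_of :: "nat \<Rightarrow> 'f::field poly \<Rightarrow> 'f vec set" where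
  "cyclic_code_of n g = (THE C. cyclic_code n C \<and> generator_polynomial n C g)"

section \<open>Cyclic codes given by powers of a primitive element\<close>

text \<open>The base field is a type \<open>'f\<close> of its own, embedded into the extension field \<open>'k\<close>
  by \<open>\<iota>\<close>.\<close>

definition minimal_polynomial :: "('f::field \<Rightarrow> 'k::field) \<Rightarrow> 'k \<Rightarrow> 'f poly" where
  "minimal_polynomial \<iota> a = (THE p. lead_coeff p = 1 \<and> poly (map_poly \<iota> p) a = 0 \<and>
     (\<forall>q. lead_coeff q = 1 \<and> poly (map_poly \<iota> q) a = 0 \<longrightarrow> degree p \<le> degree q))"

definition primitive_element :: "'k::field \<Rightarrow> bool" where
  "primitive_element \<alpha> \<longleftrightarrow> range (\<lambda>i::int. \<alpha> powi i) = UNIV - {0}"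

definition cyclic_code_exps ::
  "('f::field \<Rightarrow> 'k::field) \<Rightarrow> 'k \<Rightarrow> int list \<Rightarrow> 'f vec set" where
  "cyclic_code_exps \<iota> \<alpha> is =
     cyclic_code_of (CARD('k) - 1) (\<Prod>i\<leftarrow>is. minimal_polynomial \<iota> (\<alpha> powi i))"

end

theory Submission
  imports Defs "Jordan_Normal_Form.Char_Poly"
begin

text \<open>By minimality of the two factors of the generator polynomial, the code consists of the words
  \<open>c\<close> with \<open>c(\<alpha>) = c(\<alpha> ^ e) = 0\<close>. As \<open>e\<close> is even, a codeword of weight at most 3 gives nonzero
  elements with \<open>x + y + z = 0\<close> and \<open>x ^ e + y ^ e \<plusminus> z ^ e = 0\<close>, which in characteristic 3 can be scaled to
  \<open>t, t - 1, t + 1\<close>. Put \<open>q = 3 ^ ((m + 3) / 2)\<close>. From \<open>x ^ (2 * e) = x ^ (q + 5)\<close> one obtains a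
  quadratic equation for \<open>t ^ q\<close> over \<open>F\<^sub>3(t)\<close> with the roots \<open>t\<close> and \<open>t + w ^ 3 / (1 - w\<^sup>2)\<close>, where
  \<open>w = t ^ 3 - t\<close>. Since \<open>t ^ (q ^ 2) = t ^ 27\<close>, the first root leads to \<open>t ^ 27 = t\<close>, and applying the
  second one twice leads to an equation of degree 16 for \<open>w\<^sup>2\<close>, whose factors over \<open>F\<^sub>3\<close> have degrees
  3 and 13. As \<open>m\<close> is prime to 3 and 13, all solutions lie in the prime field, which is impossible.
  Optimality is a sphere packing argument.\<close>

section \<open>Power equations in characteristic 3\<close>

lemma cube_add_char3:
  fixes x y :: "'a::field"
  assumes "(3::'a) = 0"
  shows "(x + y) ^ 3 = x ^ 3 + y ^ 3"
proof -
  have "(x + y) ^ 3 = x ^ 3 + y ^ 3 + 3 * (x\<^sup>2 * y + x * y\<^sup>2)"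
    by Groebner_Basis.algebra
  then show ?thesis
    using assms by simp
qed

lemma cube_diff_char3:
  fixes x y :: "'a::field"
  assumes "(3::'a) = 0"
  shows "(x - y) ^ 3 = x ^ 3 - y ^ 3"
  using cube_add_char3[OF assms, of x "- y"] by simp

lemma frobenius_add:
  fixes x y :: "'a::field"
  assumes "(3::'a) = 0"
  shows "(x + y) ^ (3 ^ k) = x ^ (3 ^ k) + y ^ (3 ^ k)"
  by (induction k) (simp_all add: power_mult[of _ _ 3] mult.commute[of 3] cube_add_char3[OF assms])

lemma frobenius_minus:
  fixes x :: "'a::field"
  shows "(- x) ^ (3 ^ k) = - (x ^ (3 ^ k))"
  by (intro power_minus_odd) simp

lemma frobenius_diff:
  fixes x y :: "'a::field"
  assumes "(3::'a) = 0"
  shows "(x - y) ^ (3 ^ k) = x ^ (3 ^ k) - y ^ (3 ^ k)"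
  using frobenius_add[OF assms, of x "- y" k] by (simp add: frobenius_minus)

lemma frobenius_sum:
  fixes f :: "'b \<Rightarrow> 'a::field"
  assumes "(3::'a) = 0"
  shows "(\<Sum>i\<in>A. f i) ^ (3 ^ k) = (\<Sum>i\<in>A. f i ^ (3 ^ k))"
  by (induction A rule: infinite_finite_induct) (simp_all add: frobenius_add[OF assms])

lemma frobenius_fixed_mult:
  fixes x :: "'a::monoid_mult"
  assumes "x ^ (3 ^ a) = x"
  shows "x ^ (3 ^ (a * j)) = x"
  by (induction j) (simp_all add: assms power_add power_mult)

text \<open>Intersection rule for the fixed sets of two Frobenius powers: in
  \<open>a * u = b * v + gcd a b\<close> the exponents \<open>a * u\<close> and \<open>b * v\<close>
  act trivially. Bezout over the naturals needs \<open>a \<noteq> 0\<close>.\<close>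

lemma frobenius_fixed_gcd:
  fixes x :: "'a::monoid_mult"
  assumes a: "x ^ (3 ^ a) = x" and b: "x ^ (3 ^ b) = x"
  shows "x ^ (3 ^ gcd a b) = x"
proof (cases "a = 0")
  case False
  then obtain u v where uv: "a * u = b * v + gcd a b"
    using bezout_nat by blast
  have "x = x ^ (3 ^ (b * v + gcd a b))"
    using frobenius_fixed_mult[OF a, of u] uv by simp
  also have "\<dots> = x ^ (3 ^ gcd a b)"
    using frobenius_fixed_mult[OF b, of v] by (simp only: power_add power_mult)
  finally show ?thesis ..
qed (use b in simp)

lemma cube_eq_self_iff:
  fixes x :: "'a::field"
  shows "x ^ 3 = x \<longleftrightarrow> x = 0 \<or> x = 1 \<or> x = - 1"
proof -
  have "x ^ 3 - x = x * ((x - 1) * (x + 1))"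
    by Groebner_Basis.algebra
  then show ?thesis
    by (metis add_eq_0_iff2 mult_eq_0_iff right_minus_eq)
qed

section \<open>Elimination of the powers with exponent \<open>e\<close>\<close>

text \<open>The value \<open>T = t ^ q\<close> solves a quadratic equation over \<open>F\<^sub>3(t)\<close>, obtained by eliminating
  \<open>X, Y, Z\<close>. In characteristic 3 its discriminant is a square and one of the roots is \<open>t\<close>. The
  explicit multiple of 3, here and in the next lemma, turns the factorization into an identity
  over the integers.\<close>

lemma conic_line_intersection:
  fixes t T X Y Z :: "'a::field"
  assumes three: "(3::'a) = 0"
    and X: "X\<^sup>2 = t ^ 5 * T" and Y: "Y\<^sup>2 = (t - 1) ^ 5 * (T - 1)" and Z: "Z\<^sup>2 = (t + 1) ^ 5 * (T + 1)"
    and sum: "X + Y + Z = 0"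
  shows "T = t \<or> (T - t) * (1 - (t ^ 3 - t)\<^sup>2) = (t ^ 3 - t) ^ 3"
proof -
  define R where "R = T - t"
  \<comment> \<open>\<open>K\<close> is \<open>(Z\<^sup>2 - X\<^sup>2 - Y\<^sup>2)\<^sup>2 - 4 *
    X\<^sup>2 * Y\<^sup>2\<close> with the three squares substituted. It vanishes because
    \<open>X + Y + Z = 0\<close> gives
    \<open>Z\<^sup>2 - X\<^sup>2 - Y\<^sup>2 = 2 * X * Y\<close>.\<close>
  define K where "K = ((t + 1) ^ 5 * (T + 1) - t ^ 5 * T - (t - 1) ^ 5 * (T - 1))\<^sup>2
      - 4 * (t ^ 5 * T) * ((t - 1) ^ 5 * (T - 1))"
  have Zeq: "Z = - (X + Y)"
    using sum by (simp add: add_eq_0_iff2)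
  have "(Z\<^sup>2 - X\<^sup>2 - Y\<^sup>2)\<^sup>2 - 4 * X\<^sup>2 * Y\<^sup>2 = 0"
    unfolding Zeq by Groebner_Basis.algebra
  then have "K = 0"
    unfolding K_def X Y Z by (simp add: mult.assoc)
  moreover have "K = R * (R * (1 - (t ^ 3 - t)\<^sup>2) - (t ^ 3 - t) ^ 3)
      + 3 * (R^2 + 16*t*R + 48*t^2 + 27*t^2*R^2 + 213*t^3*R + 320*t^4 + 146*t^4*R^2
        + 629*t^5*R + 628*t^6 + 127*t^6*R^2 + 399*t^7*R + 300*t^8 + 20*t^8*R^2 + 47*t^9*R
        + 28*t^10 - t^10*R^2 - 2*t^11*R - t^12)"
  proof -
    have T: "T = t + R"
      by (simp add: R_def)
    show ?thesis
      unfolding K_def T by Groebner_Basis.algebra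
  qed
  ultimately have "R * (R * (1 - (t ^ 3 - t)\<^sup>2) - (t ^ 3 - t) ^ 3) = 0"
    by (simp add: three)
  then show ?thesis
    by (simp add: R_def)
qed

text \<open>Applying the second solution twice, with \<open>W = w ^ q\<close> and \<open>t ^ (q ^ 2) = t ^ 27\<close>, gives a
  polynomial equation for \<open>v = w\<^sup>2\<close>, which factors in characteristic 3.\<close>

lemma iterated_solution:
  fixes w :: "'a::field"
  assumes three: "(3::'a) = 0" and w0: "w \<noteq> 0"
    and R: "R * (1 - w\<^sup>2) = w ^ 3" and W: "W = w + R ^ 3 - R"
    and R': "R' * (1 - W\<^sup>2) = W ^ 3" and sum: "R + R' = w ^ 9 + w ^ 3 + w"
    and v: "v = w\<^sup>2"
  shows "v ^ 3 = v ^ 2 + v + 1 \<or>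
    v ^ 13 = 1 - v ^ 3 + v ^ 4 - v ^ 5 + v ^ 6 - v ^ 7 + v ^ 8 - v ^ 9 - v ^ 10"
proof -
  \<comment> \<open>Powers of \<open>d\<close> clear the denominators: \<open>R = w * v / d\<close>,
    \<open>W = w * B / d ^ 3\<close> and \<open>1 - W\<^sup>2 = E / d ^ 6\<close>. Up to powers of
    \<open>w\<close>, only polynomials in \<open>v\<close> remain.\<close>
  define d where "d = 1 - v"
  define B where "B = d ^ 3 - v * d\<^sup>2 + v ^ 4"
  define E where "E = d ^ 6 - v * B\<^sup>2"
  have d0: "d \<noteq> 0"
    using R w0 v unfolding d_def by auto
  have Rd: "R * d = w * v"
    using R v by (simp add: d_def power3_eq_cube power2_eq_square mult_ac)
  have Wd: "W * d ^ 3 = w * B"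
  proof -
    have "W * d ^ 3 = w * d ^ 3 + (R * d) ^ 3 - (R * d) * d\<^sup>2"
      unfolding W by Groebner_Basis.algebra
    then show ?thesis
      unfolding Rd B_def using v by Groebner_Basis.algebra
  qed
  have E: "(1 - W\<^sup>2) * d ^ 6 = E"
  proof -
    have "(1 - W\<^sup>2) * d ^ 6 = d ^ 6 - (W * d ^ 3)\<^sup>2"
      by Groebner_Basis.algebra
    then show ?thesis
      unfolding Wd E_def v by Groebner_Basis.algebra
  qed
  have "R' * E * d ^ 3 = w ^ 3 * B ^ 3"
  proof -
    have "R' * E * d ^ 3 = (R' * (1 - W\<^sup>2)) * d ^ 9"
      unfolding E[symmetric] by Groebner_Basis.algebra
    also have "\<dots> = (W * d ^ 3) ^ 3"
      unfolding R' by Groebner_Basis.algebra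
    finally show ?thesis
      unfolding Wd by Groebner_Basis.algebra
  qed
  \<comment> \<open>The equation \<open>sum\<close> is multiplied by \<open>E * d ^ 3\<close>, so
    that no division by \<open>E\<close> occurs; the common factor \<open>w\<close> is cancelled
    afterwards.\<close>
  then have "w * (v * d\<^sup>2 * E + v * B ^ 3) = (R * d) * d\<^sup>2 * E + R' * E * d ^ 3"
    unfolding Rd v by Groebner_Basis.algebra
  also have "\<dots> = (R + R') * E * d ^ 3"
    by Groebner_Basis.algebra
  also have "\<dots> = w * ((v ^ 4 + v + 1) * d ^ 3 * E)"
    unfolding sum v by Groebner_Basis.algebra
  finally have "v * d\<^sup>2 * E + v * B ^ 3 - (v ^ 4 + v + 1) * d ^ 3 * E = 0"
    using w0 by simp
  moreover have "v * d\<^sup>2 * E + v * B ^ 3 - (v ^ 4 + v + 1) * d ^ 3 * E =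
    (1 + v + v ^ 2 - v ^ 3) *
      (v ^ 13 + v ^ 10 + v ^ 9 - v ^ 8 + v ^ 7 - v ^ 6 + v ^ 5 - v ^ 4 + v ^ 3 - 1) +
      3 * (4*v - 19*v^2 + 63*v^3 - 142*v^4 + 221*v^5 - 250*v^6 + 228*v^7 - 199*v^8 + 178*v^9
        - 149*v^10 + 105*v^11 - 61*v^12 + 28*v^13 - 10*v^14 + 2*v^15)"
    unfolding E_def B_def d_def by Groebner_Basis.algebra
  ultimately have "(1 + v + v ^ 2 - v ^ 3) *
      (v ^ 13 + v ^ 10 + v ^ 9 - v ^ 8 + v ^ 7 - v ^ 6 + v ^ 5 - v ^ 4 + v ^ 3 - 1) = 0"
    by (simp add: three)
  then have "1 + v + v ^ 2 - v ^ 3 = 0 \<or>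
      v ^ 13 + v ^ 10 + v ^ 9 - v ^ 8 + v ^ 7 - v ^ 6 + v ^ 5 - v ^ 4 + v ^ 3 - 1 = 0"
    by (simp only: mult_eq_0_iff)
  then show ?thesis
    by Groebner_Basis.algebra
qed

section \<open>Frobenius orbits computed on coefficient lists\<close>

text \<open>Coefficient lists, lowest degree first and with entries in \<open>{-1, 0, 1}\<close>, represent elements of
  \<open>F\<^sub>3[x] / (x ^ n - r)\<close>, so that the Frobenius orbit of a root can be computed.\<close>

definition reduce3 :: "int \<Rightarrow> int" where
  "reduce3 c = (if c > 1 then c - 3 else if c < - 1 then c + 3 else c)"

fun add_scaled :: "int \<Rightarrow> int list \<Rightarrow> int list \<Rightarrow> int list" where
  "add_scaled c (a # as) (b # bs) = reduce3 (a + c * b) # add_scaled c as bs"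
| "add_scaled c as bs = []"

text \<open>The shift moves the top coefficient to \<open>x ^ n\<close>, from where it is folded
  back through \<open>x ^ n = r\<close>.\<close>

definition times_x :: "int list \<Rightarrow> int list \<Rightarrow> int list" where
  "times_x r cs = add_scaled (last cs) (0 # butlast cs) r"

text \<open>Cubing is additive and fixes the coefficients, so Horner's scheme reads
  \<open>(c + x * p) ^ 3 = c + x ^ 3 * p ^ 3\<close> and only multiplications by \<open>x\<close>
  occur. The last list is the constant 1, padded to the length of \<open>r\<close>.\<close>

fun cube_mod :: "int list \<Rightarrow> int list \<Rightarrow> int list" where
  "cube_mod r [] = map (\<lambda>_. 0) r"
| "cube_mod r (c # cs) =
    add_scaled c (times_x r (times_x r (times_x r (cube_mod r cs)))) (1 # map (\<lambda>_. 0) (tl r))"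

lemma of_int_reduce3:
  assumes "(3::'a::ring_1) = 0"
  shows "(of_int (reduce3 c) :: 'a) = of_int c"
  using assms by (simp add: reduce3_def)

lemma length_add_scaled: "length (add_scaled c as bs) = min (length as) (length bs)"
  by (induction c as bs rule: add_scaled.induct) simp_all

lemma horner_sum_add_scaled:
  fixes x :: "'a::field"
  assumes "(3::'a) = 0" and "length as = length bs"
  shows "horner_sum of_int x (add_scaled k as bs) =
    horner_sum of_int x as + of_int k * horner_sum of_int x bs"
  using assms(2)
  by (induction as bs rule: list_induct2)
     (simp_all add: of_int_reduce3[OF assms(1)] algebra_simps)

lemma horner_sum_zero: "horner_sum of_int x (map (\<lambda>_. 0) cs) = (0::'a::field)"
  by (induction cs) simp_all

lemma length_times_x: "cs \<noteq> [] \<Longrightarrow> length (times_x r cs) = min (length cs) (length r)"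
  by (simp add: times_x_def length_add_scaled)

lemma horner_sum_times_x:
  fixes x :: "'a::field"
  assumes three: "(3::'a) = 0" and r: "r \<noteq> []" and len: "length cs = length r"
    and x: "x ^ length r = horner_sum of_int x r"
  shows "horner_sum of_int x (times_x r cs) = x * horner_sum of_int x cs"
proof -
  have "horner_sum of_int x (times_x r cs) =
      x * horner_sum of_int x (butlast cs) + of_int (last cs) * x ^ length r"
    using r len unfolding times_x_def x by (subst horner_sum_add_scaled[OF three]) auto
  also have "\<dots> = x * horner_sum of_int x (butlast cs @ [last cs])"
    using r len unfolding horner_sum_append
    by (simp add: algebra_simps flip: power_Suc)
  also have "butlast cs @ [last cs] = cs"
    using r len by (intro append_butlast_last_id) auto
  finally show ?thesis .
qed

text \<open>Evaluation at a root carries the list computation into the field. The length is part of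
  the induction because \<open>horner_sum_times_x\<close> requires it.\<close>

lemma horner_sum_cube_mod:
  fixes x :: "'a::field"
  assumes three: "(3::'a) = 0" and r: "r \<noteq> []"
    and x: "x ^ length r = horner_sum of_int x r"
  shows "horner_sum of_int x (cube_mod r cs) = horner_sum of_int x cs ^ 3 \<and>
    length (cube_mod r cs) = length r"
proof (induction cs)
  case Nil
  then show ?case
    by (simp add: horner_sum_zero)
next
  case (Cons c cs)
  have c3: "of_int c ^ 3 = (of_int c :: 'a)"
    by (induction c rule: int_induct[of _ 0])
       (simp_all add: cube_add_char3[OF three] cube_diff_char3[OF three])
  have len: "length (times_x r (times_x r (times_x r (cube_mod r cs)))) = length r"
    using Cons.IH r by (subst length_times_x; auto simp: length_times_x simp flip: length_greater_0_conv)+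
  have "horner_sum of_int x (times_x r (times_x r (times_x r (cube_mod r cs)))) =
      x ^ 3 * horner_sum of_int x cs ^ 3"
    using Cons.IH r
    by (simp add: horner_sum_times_x[OF three r _ x] length_times_x power3_eq_cube mult.assoc
        flip: length_greater_0_conv)
  then have "horner_sum of_int x (cube_mod r (c # cs)) =
      x ^ 3 * horner_sum of_int x cs ^ 3 + of_int c"
    using r len by (simp add: horner_sum_add_scaled[OF three] horner_sum_zero)
  also have "\<dots> = horner_sum of_int x (c # cs) ^ 3"
    by (simp add: cube_add_char3[OF three] c3 power_mult_distrib)
  finally show ?case
    using len r by (simp add: length_add_scaled)
qed

lemma frobenius_via_cube_mod:
  fixes x :: "'a::field"
  assumes "(3::'a) = 0" and "r \<noteq> []"
    and "x ^ length r = horner_sum of_int x r"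
  shows "horner_sum of_int x ((cube_mod r ^^ k) cs) = horner_sum of_int x cs ^ (3 ^ k)"
  by (induction k) (simp_all add: horner_sum_cube_mod[OF assms] power_mult mult.commute[of 3])

text \<open>Three cubings on coefficient lists return the class of \<open>x\<close> to
  itself.\<close>

lemma degree_3_root_fixed:
  fixes v :: "'a::field"
  assumes "(3::'a) = 0" and "v ^ 3 = v ^ 2 + v + 1"
  shows "v ^ 27 = v"
proof -
  let ?r = "[1, 1, 1] :: int list" and ?x = "[0, 1, 0] :: int list"
  have "v ^ length ?r = horner_sum of_int v ?r"
    using assms(2) by (simp add: power2_eq_square power3_eq_cube algebra_simps)
  then have "horner_sum of_int v ((cube_mod ?r ^^ 3) ?x) = horner_sum of_int v ?x ^ (3 ^ 3)"
    by (intro frobenius_via_cube_mod assms(1)) simp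
  also have "(cube_mod ?r ^^ 3) ?x = cube_mod ?r (cube_mod ?r (cube_mod ?r ?x))"
    by (simp only: numeral_3_eq_3 funpow.simps o_apply id_apply)
  also have "\<dots> = ?x"
    by (simp add: times_x_def reduce3_def)
  finally show ?thesis
    by simp
qed

text \<open>The same orbit computation closes up after thirteen cubings.\<close>

lemma degree_13_root_fixed:
  fixes v :: "'a::field"
  assumes "(3::'a) = 0"
    and "v ^ 13 = 1 - v ^ 3 + v ^ 4 - v ^ 5 + v ^ 6 - v ^ 7 + v ^ 8 - v ^ 9 - v ^ 10"
  shows "v ^ (3 ^ 13) = v"
proof -
  let ?r = "[1, 0, 0, -1, 1, -1, 1, -1, 1, -1, -1, 0, 0] :: int list"
  let ?x = "[0, 1, 0, 0, 0, 0, 0, 0, 0, 0, 0, 0, 0] :: int list"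
  have "length ?r = 13"
    by simp
  then have "v ^ length ?r = v ^ 13"
    by (simp only:)
  also have "\<dots> = horner_sum of_int v ?r"
    unfolding assms(2) horner_sum_simps of_int_0 of_int_1 of_int_minus by Groebner_Basis.algebra
  finally have "horner_sum of_int v ((cube_mod ?r ^^ 13) ?x) = horner_sum of_int v ?x ^ (3 ^ 13)"
    by (intro frobenius_via_cube_mod assms(1)) simp
  also have "(cube_mod ?r ^^ 13) ?x = ?x"
  proof -
    have "(f ^^ 13) a = f (f (f (f (f (f (f (f (f (f (f (f (f a))))))))))))"
      for f :: "int list \<Rightarrow> int list" and a
      by (simp add: numeral_eq_Suc)
    then show ?thesis
      by (simp add: times_x_def reduce3_def)
  qed
  finally show ?thesis
    by simp
qed

text \<open>The squares of the three terms fit \<open>conic_line_intersection\<close>. Each case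
  makes \<open>t\<close> or \<open>v\<close> a fixed point of the third or thirteenth Frobenius
  power; with \<open>fixed\<close> and the coprimality of \<open>m\<close> only the prime field is
  left.\<close>

lemma shifted_power_relation:
  fixes t s :: "'a::field" and m e :: nat
  assumes three: "(3::'a) = 0" and fixed: "\<And>x::'a. x ^ (3 ^ m) = x"
    and m: "odd m" "coprime 3 m" "coprime 13 m" and e: "2 * e = 3 ^ ((m + 3) div 2) + 5"
    and s: "s\<^sup>2 = 1" and eq: "t ^ e + (t - 1) ^ e + s * (t + 1) ^ e = 0"
  shows "t ^ 3 = t"
proof -
  define h where "h = (m + 3) div 2"
  have h: "h + h = m + 3"
    using m(1) by (auto simp: h_def elim!: oddE)
  have base: "x ^ 3 = x" if "x ^ (3 ^ k) = x" "coprime k m" for x :: 'a and k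
    using frobenius_fixed_gcd[OF that(1) fixed[of x]] that(2) by simp
  \<comment> \<open>Raising to the power \<open>3 ^ h\<close> twice amounts to \<open>m + 3\<close>
    cubings, of which \<open>m\<close> act trivially.\<close>
  have frob2: "(x ^ 3 ^ h) ^ 3 ^ h = x ^ 27" for x :: 'a
  proof -
    have "(x ^ 3 ^ h) ^ 3 ^ h = x ^ 3 ^ (m + 3)"
      by (simp add: h flip: power_mult power_add)
    also have "\<dots> = x ^ 27"
      by (simp only: power_add power_mult fixed) simp
    finally show ?thesis .
  qed
  have two: "(2::'a) \<noteq> 0"
  proof
    assume "(2::'a) = 0"
    then have "(3::'a) - 2 = 0"
      using three by simp
    then show False
      by simp
  qed
  have double: "(x ^ e)\<^sup>2 = x ^ 5 * x ^ 3 ^ h" for x :: 'a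
  proof -
    have "(x ^ e)\<^sup>2 = x ^ (2 * e)"
      by (simp only: mult.commute[of 2] power_mult)
    also have "\<dots> = x ^ 5 * x ^ 3 ^ h"
      unfolding e h_def power_add by (rule mult.commute)
    finally show ?thesis .
  qed
  define T where "T = t ^ 3 ^ h"
  have "T = t \<or> (T - t) * (1 - (t ^ 3 - t)\<^sup>2) = (t ^ 3 - t) ^ 3"
  proof (rule conic_line_intersection[OF three])
    show "(t ^ e)\<^sup>2 = t ^ 5 * T"
      by (simp add: double T_def)
    show "((t - 1) ^ e)\<^sup>2 = (t - 1) ^ 5 * (T - 1)"
      by (simp add: double T_def frobenius_diff[OF three])
    show "(s * (t + 1) ^ e)\<^sup>2 = (t + 1) ^ 5 * (T + 1)"
      by (simp add: double T_def s power_mult_distrib frobenius_add[OF three])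
  qed (rule eq)
  then show ?thesis
  proof
    assume "T = t"
    then have "t ^ (3 ^ 3) = t"
      using frob2[of t] by (simp add: T_def)
    then show ?thesis
      using m(2) by (rule base)
  next
    define w where "w = t ^ 3 - t"
    define R where "R = T - t"
    define v where "v = w\<^sup>2"
    assume "(T - t) * (1 - (t ^ 3 - t)\<^sup>2) = (t ^ 3 - t) ^ 3"
    then have R: "R * (1 - w\<^sup>2) = w ^ 3"
      by (simp add: R_def w_def)
    \<comment> \<open>Here \<open>T = t + R\<close> is put into
      \<open>w ^ 3 ^ h = T ^ 3 - T\<close>.\<close>
    have W: "w ^ 3 ^ h = w + R ^ 3 - R"
      by (simp add: w_def R_def T_def frobenius_diff[OF three] cube_diff_char3[OF three])
        (simp add: mult.commute flip: power_mult)
    have "(R * (1 - w\<^sup>2)) ^ 3 ^ h = (w ^ 3) ^ 3 ^ h"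
      by (simp only: R)
    then have R': "R ^ 3 ^ h * (1 - (w ^ 3 ^ h)\<^sup>2) = (w ^ 3 ^ h) ^ 3"
      by (simp add: power_mult_distrib frobenius_diff[OF three])
        (simp add: mult.commute flip: power_mult)
    \<comment> \<open>As \<open>R ^ 3 ^ h = t ^ 27 - T\<close>, the sum is
      \<open>t ^ 27 - t\<close>, which telescopes through \<open>t ^ 9\<close> and
      \<open>t ^ 3\<close>.\<close>
    have "R + R ^ 3 ^ h = t ^ 27 - t"
      by (simp add: R_def T_def frobenius_diff[OF three] frob2)
    also have "\<dots> = w ^ 9 + w ^ 3 + w"
      using frobenius_diff[OF three, of "t ^ 3" t 2] frobenius_diff[OF three, of "t ^ 3" t 1]
      by (simp add: w_def flip: power_mult)
    finally have sum: "R + R ^ 3 ^ h = w ^ 9 + w ^ 3 + w" .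
    show ?thesis
    proof (rule ccontr)
      assume "t ^ 3 \<noteq> t"
      then have "w \<noteq> 0"
        by (simp add: w_def)
      then have v: "v ^ 3 = v ^ 2 + v + 1 \<or>
          v ^ 13 = 1 - v ^ 3 + v ^ 4 - v ^ 5 + v ^ 6 - v ^ 7 + v ^ 8 - v ^ 9 - v ^ 10"
        using iterated_solution[OF three _ R W R' sum v_def] by simp
      then have "v ^ 3 = v"
      proof
        assume "v ^ 3 = v ^ 2 + v + 1"
        then have "v ^ (3 ^ 3) = v"
          using degree_3_root_fixed[OF three] by simp
        then show ?thesis
          using m(2) by (rule base)
      next
        assume "v ^ 13 = 1 - v ^ 3 + v ^ 4 - v ^ 5 + v ^ 6 - v ^ 7 + v ^ 8 - v ^ 9 - v ^ 10"
        then have "v ^ (3 ^ 13) = v"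
          by (rule degree_13_root_fixed[OF three])
        then show ?thesis
          using m(3) by (rule base)
      qed
      \<comment> \<open>The right-hand side of the degree 13 equation takes the value 7 at
        \<open>v = - 1\<close>.\<close>
      moreover have "(7::'a) = 1"
      proof -
        have "(7::'a) = 3 * 2 + 1"
          by simp
        then show ?thesis
          unfolding three by simp
      qed
      moreover have "(1::'a) \<noteq> - 1"
        using two by (metis one_add_one add.right_inverse)
      \<comment> \<open>Neither factor has a root in the prime field, as its three elements show in
        turn.\<close>
      ultimately consider "v = 0" | "v = 1" | "v = - 1"
        unfolding cube_eq_self_iff by blast
      then show False
      proof cases
        case 1
        then show ?thesis
          using v by simp
      next
        case 2
        then show ?thesis
          using v three \<open>1 \<noteq> - 1\<close> by simp
      next
        case 3
        then show ?thesis
          using v \<open>7 = 1\<close> \<open>1 \<noteq> - 1\<close> by simp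
      qed
    qed
  qed
qed

text \<open>Two of the three signs agree; multiplying by this sign leaves a single sign
  \<open>s\<close> on the third term. Scaling by the difference of the other two elements then leads
  to \<open>shifted_power_relation\<close>.\<close>

lemma no_weight_3_relation:
  fixes x y z a b c :: "'a::field" and m e :: nat
  assumes three: "(3::'a) = 0" and fixed: "\<And>x::'a. x ^ (3 ^ m) = x"
    and m: "odd m" "coprime 3 m" "coprime 13 m"
    and e: "2 * e = 3 ^ ((m + 3) div 2) + 5" "even e"
    and nz: "x \<noteq> 0" "y \<noteq> 0" "z \<noteq> 0" and distinct: "x \<noteq> y" "y \<noteq> z" "x \<noteq> z"
    and abc: "a \<in> {1, -1}" "b \<in> {1, -1}" "c \<in> {1, -1}"
    and sum: "a * x + b * y + c * z = 0" and sume: "a * x ^ e + b * y ^ e + c * z ^ e = 0"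
  shows False
proof -
  have *: False
    if nz: "x \<noteq> 0" "y \<noteq> 0" "z \<noteq> 0" and xy: "x \<noteq> y" and s: "s\<^sup>2 = 1"
      and sum: "x + y + s * z = 0" and sume: "x ^ e + y ^ e + s * z ^ e = 0"
    for x y z s :: 'a
  proof -
    \<comment> \<open>Division by \<open>x - y\<close> turns the first two elements into
      \<open>t\<close> and \<open>t - 1\<close>; since \<open>- 2 = 1\<close>, the linear relation
      then gives \<open>s * z / d = t + 1\<close>.\<close>
    define d where "d = x - y"
    define t where "t = x / d"
    have d: "d \<noteq> 0"
      using xy by (simp add: d_def)
    have x: "x = t * d"
      using d by (simp add: t_def)
    have y: "y = (t - 1) * d"
      using x by (simp add: d_def algebra_simps)
    have "s * z = (t + 1) * d - 3 * t * d"
      using sum x y by Groebner_Basis.algebra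
    then have sz: "s * z = (t + 1) * d"
      by (simp add: three)
    have s_e: "s ^ e = 1"
      using s e(2) by (auto elim!: evenE simp: power_mult)
    \<comment> \<open>As \<open>e\<close> is even, \<open>z\<close> may be replaced by
      \<open>s * z\<close> inside the power.\<close>
    have "x ^ e + y ^ e + s * (s * z) ^ e = 0"
      using sume s_e by (simp add: power_mult_distrib)
    then have "(t ^ e + (t - 1) ^ e + s * (t + 1) ^ e) * d ^ e = 0"
      unfolding x y sz by (simp only: power_mult_distrib mult.assoc distrib_right[of _ _ "d ^ e"])
    then have "t ^ e + (t - 1) ^ e + s * (t + 1) ^ e = 0"
      using d by simp
    then have "t ^ 3 = t"
      by (rule shifted_power_relation[OF three fixed m e(1) s])
    moreover have "s \<noteq> 0"
      using s by auto
    \<comment> \<open>Each of the values 0, 1 and -1 of \<open>t\<close> makes one of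
      \<open>x\<close>, \<open>y\<close>, \<open>s * z\<close> vanish.\<close>
    ultimately show False
      using nz x y sz unfolding cube_eq_self_iff by auto
  qed
  have sq: "a * a = 1" "b * b = 1" "c * c = 1"
    using abc by auto
  have sq2: "(a * b)\<^sup>2 = 1" "(a * c)\<^sup>2 = 1"
    using abc by auto
  have lin: "p + q + (r * k) * s = 0" if "r * p + r * q + k * s = 0" "r * r = 1" for p q r s k :: 'a
    using that by Groebner_Basis.algebra
  consider "a = b" | "b = c" | "a = c"
    using abc by auto
  then show False
  proof cases
    case 1
    have "x + y + (a * c) * z = 0" "x ^ e + y ^ e + (a * c) * z ^ e = 0"
      by (rule lin; use 1 sq sum sume in \<open>simp add: add_ac\<close>)+
    then show False
      by (rule *[OF nz(1,2,3) distinct(1) sq2(2)])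
  next
    case 2
    have "y + z + (b * a) * x = 0" "y ^ e + z ^ e + (b * a) * x ^ e = 0"
      by (rule lin; use 2 sq sum sume in \<open>simp add: add_ac\<close>)+
    then show False
      by (rule *[OF nz(2,3,1) distinct(2) sq2(1)[unfolded mult.commute[of a]]])
  next
    case 3
    have "x + z + (a * b) * y = 0" "x ^ e + z ^ e + (a * b) * y ^ e = 0"
      by (rule lin; use 3 sq sum sume in \<open>simp add: add_ac\<close>)+
    then show False
      by (rule *[OF nz(1,3,2) distinct(3) sq2(1)])
  qed
qed

text \<open>Opposite signs would force \<open>x = y\<close>. Equal signs force
  \<open>y = - x\<close>, and for even \<open>e\<close> the second relation becomes
  \<open>2 * x ^ e = 0\<close>.\<close>

lemma no_weight_2_relation:
  fixes x y a b :: "'a::field"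
  assumes three: "(3::'a) = 0" and e: "even e"
    and nz: "x \<noteq> 0" and distinct: "x \<noteq> y"
    and ab: "a \<in> {1, -1}" "b \<in> {1, -1}"
    and sum: "a * x + b * y = 0" and sume: "a * x ^ e + b * y ^ e = 0"
  shows False
proof -
  have "a = b"
  proof (rule ccontr)
    assume "a \<noteq> b"
    then have "b = - a" "a \<noteq> 0"
      using ab by auto
    then show False
      using sum distinct by simp
  qed
  have "a \<noteq> 0"
    using ab by auto
  have "a * (x + y) = 0"
    using sum \<open>a = b\<close> by (simp add: distrib_left)
  then have "y = - x"
    using \<open>a \<noteq> 0\<close> by (simp add: add_eq_0_iff)
  then have "2 * x ^ e = 0"
    using sume \<open>a = b\<close> \<open>a \<noteq> 0\<close> e by auto
  moreover have "(2::'a) = - 1"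
    using three by (simp add: eq_neg_iff_add_eq_0)
  ultimately show False
    using nz by simp
qed

section \<open>Linear codes over finite fields\<close>

text \<open>Coordinates in a basis identify the space with the extensional functions from the basis
  to the scalars. A finite basis exists because the finite carrier spans itself.\<close>

lemma (in vectorspace) card_carrier_eq_power_dim:
  assumes V: "finite (carrier V)"
  shows "card (carrier V) = card (carrier K) ^ dim"
proof -
  have "fin_dim"
    unfolding fin_dim_def using V span_is_subset2[of "carrier V"] in_own_span[of "carrier V"] by blast
  then obtain B where B: "finite B" "basis B"
    using finite_basis_exists by blast
  then have BC: "B \<subseteq> carrier V"
    by (simp add: basis_def)
  have "bij_betw (\<lambda>a. lincomb a B) (B \<rightarrow>\<^sub>E carrier K) (carrier V)"
  proof (rule bij_betw_imageI)
    have ex1: "\<exists>!a. a \<in> B \<rightarrow>\<^sub>E carrier K \<and> lincomb a B = v" if "v \<in> carrier V" for v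
      using basis_criterion[OF B(1) BC] B(2) that by blast
    have closed: "lincomb a B \<in> carrier V" if "a \<in> B \<rightarrow>\<^sub>E carrier K" for a
      using that BC by (intro lincomb_closed) (auto simp: PiE_def)
    show "inj_on (\<lambda>a. lincomb a B) (B \<rightarrow>\<^sub>E carrier K)"
      using ex1 closed by (intro inj_onI) metis
    show "(\<lambda>a. lincomb a B) ` (B \<rightarrow>\<^sub>E carrier K) = carrier V"
      using ex1 closed by (auto simp: image_iff) metis
  qed
  then have "card (carrier V) = card (B \<rightarrow>\<^sub>E carrier K)"
    by (metis bij_betw_same_card)
  also have "\<dots> = card (carrier K) ^ dim"
    using B by (simp add: card_PiE dim_basis)
  finally show ?thesis .
qed

lemma linear_code_iff:
  "linear_code n C \<longleftrightarrow> C \<subseteq> carrier_vec n \<and> 0\<^sub>v n \<in> C \<and>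
    (\<forall>u\<in>C. \<forall>v\<in>C. u + v \<in> C) \<and> (\<forall>c. \<forall>v\<in>C. c \<cdot>\<^sub>v v \<in> C)"
  unfolding linear_code_def VectorSpace.subspace_def LinearCombinations.submodule_def
  using vec_vs vec_module by (auto simp: module_vec_simps)

lemma bij_betw_list_of_vec:
  "bij_betw list_of_vec (carrier_vec n) {xs. length xs = n}"
  by (rule bij_betw_byWitness[where f' = vec_of_list]) (auto simp: vec_list list_vec intro: carrier_vecI)

lemma finite_carrier_vec: "finite (carrier_vec n :: 'a::finite vec set)"
  using bij_betw_finite[OF bij_betw_list_of_vec[where 'a = 'a and n = n]] finite_lists_length_eq[of "UNIV :: 'a set" n] by simp

lemma card_carrier_vec: "card (carrier_vec n :: 'a::finite vec set) = CARD('a) ^ n"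
  using bij_betw_same_card[OF bij_betw_list_of_vec[where 'a = 'a and n = n]] card_lists_length_eq[of "UNIV :: 'a set" n] by simp

text \<open>Dimensions of codes can thus be found by counting words.\<close>

lemma card_linear_code:
  fixes C :: "'f::{field,finite} vec set"
  assumes "linear_code n C"
  shows "card C = CARD('f) ^ code_dim n C"
proof -
  have "vectorspace class_ring ((module_vec TYPE('f) n)\<lparr>carrier := C\<rparr>)"
    using vectorspace.subspace_is_vs[OF vec_vs] assms by (simp add: linear_code_def)
  from vectorspace.card_carrier_eq_power_dim[OF this] show ?thesis
    using assms finite_subset[OF _ finite_carrier_vec] by (auto simp: code_dim_def linear_code_iff)
qed

section \<open>Minimum distance and the sphere packing bound\<close>

lemma finite_distances:
  fixes C :: "'f::finite vec set"
  assumes "C \<subseteq> carrier_vec n"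
  shows "finite {hamming_distance u v | u v. u \<in> C \<and> v \<in> C \<and> u \<noteq> v}"
proof -
  have "finite C"
    using assms finite_carrier_vec by (rule finite_subset)
  then have "finite ((\<lambda>(u, v). hamming_distance u v) ` (C \<times> C))"
    by simp
  then show ?thesis
    by (rule rev_finite_subset) auto
qed

lemma min_distance_le:
  fixes C :: "'f::finite vec set"
  assumes "C \<subseteq> carrier_vec n" "u \<in> C" "v \<in> C" "u \<noteq> v"
  shows "min_distance C \<le> hamming_distance u v"
  unfolding min_distance_def using assms by (intro Min_le finite_distances) auto

lemma min_distance_ge:
  fixes C :: "'f::finite vec set"
  assumes "C \<subseteq> carrier_vec n" "card C > 1"
    and "\<And>u v. u \<in> C \<Longrightarrow> v \<in> C \<Longrightarrow> u \<noteq> v \<Longrightarrow> d \<le> hamming_distance u v"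
  shows "d \<le> min_distance C"
proof -
  have "\<not> C \<subseteq> {u}" for u
  proof
    assume "C \<subseteq> {u}"
    then have "card C \<le> card {u}"
      by (intro card_mono) auto
    then show False
      using assms(2) by simp
  qed
  moreover have "C \<noteq> {}"
    using assms(2) by auto
  ultimately have "{hamming_distance u v | u v. u \<in> C \<and> v \<in> C \<and> u \<noteq> v} \<noteq> {}"
    by blast
  then show ?thesis
    unfolding min_distance_def using assms by (subst Min_ge_iff[OF finite_distances]) auto
qed

text \<open>For \<open>i < j < n\<close> and nonzero \<open>a\<close>, \<open>b\<close> this runs
  through words of weight 2 without repetition; the larger index comes first to suit
  \<open>SIGMA\<close>.\<close>

definition pair_vec :: "nat \<Rightarrow> (nat \<times> nat) \<times> 'f \<times> 'f \<Rightarrow> 'f::zero vec" where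
  "pair_vec n = (\<lambda>((j, i), (a, b)). vec n (\<lambda>k. if k = i then a else if k = j then b else 0))"

lemma inj_on_pair_vec:
  "inj_on (pair_vec n :: _ \<Rightarrow> 'f::zero vec) ((SIGMA j:{..<n}. {..<j}) \<times> (- {0}) \<times> (- {0}))"
    (is "inj_on _ ?P")
proof (rule inj_onI)
  fix p p' :: "(nat \<times> nat) \<times> 'f \<times> 'f"
  assume P: "p \<in> ?P" "p' \<in> ?P" and eq: "pair_vec n p = pair_vec n p'"
  obtain j i a b where p: "p = ((j, i), (a, b))"
    by (metis surj_pair)
  obtain j' i' a' b' where p': "p' = ((j', i'), (a', b'))"
    by (metis surj_pair)
  have "(if k = i then a else if k = j then b else 0) =
      (if k = i' then a' else if k = j' then b' else 0)" if "k < n" for k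
    using arg_cong[OF eq, of "\<lambda>v. v $ k"] that by (simp add: p p' pair_vec_def)
  from this[of i] this[of j] this[of i'] this[of j'] P show "p = p'"
    by (auto simp: p p' split: if_splits)
qed

lemma card_increasing_pairs: "2 * card (SIGMA j:{..<n::nat}. {..<j}) = n * (n - 1)"
proof -
  have "2 * (\<Sum>j<n. j) = n * (n - 1)"
  proof (induction n)
    case (Suc n)
    then show ?case
      by (cases n) auto
  qed simp
  then show ?thesis
    by (simp add: card_SigmaI)
qed

text \<open>Words at distance 2 from different codewords are different if the minimum distance is at
  least 5. Counting only these words, rather than whole balls of radius 2, suffices.\<close>

lemma sphere_packing:
  fixes D :: "'f::{field,finite} vec set"
  assumes D: "D \<subseteq> carrier_vec n"
    and dist: "\<And>u v. u \<in> D \<Longrightarrow> v \<in> D \<Longrightarrow> u \<noteq> v \<Longrightarrow> 5 \<le> hamming_distance u v"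
  shows "card D * (n * (n - 1) * (CARD('f) - 1)\<^sup>2) \<le> 2 * CARD('f) ^ n"
proof -
  define P where "P = ((SIGMA j:{..<n}. {..<j}) \<times> (- {0::'f}) \<times> (- {0::'f}))"
  have two: "card {k. k < n \<and> pair_vec n p $ k \<noteq> 0} \<le> 2" if "p \<in> P" for p
  proof -
    obtain j i a b where p: "p = ((j, i), (a, b))"
      by (metis surj_pair)
    have "card {k. k < n \<and> pair_vec n p $ k \<noteq> 0} \<le> card {i, j}"
      by (intro card_mono) (auto simp: p pair_vec_def split: if_splits)
    also have "\<dots> \<le> 2"
      by (simp add: card_insert_if)
    finally show ?thesis .
  qed
  have carrier: "pair_vec n p \<in> carrier_vec n" for p :: "(nat \<times> nat) \<times> 'f \<times> 'f"
    by (cases p) (auto simp: pair_vec_def)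
  have "inj_on (\<lambda>(u, p). u + pair_vec n p) (D \<times> P)"
  proof (rule inj_onI, clarify)
    fix u p u' p'
    assume u: "u \<in> D" "u' \<in> D" and p: "p \<in> P" "p' \<in> P"
      and eq: "u + pair_vec n p = u' + pair_vec n p'"
    have cu: "u \<in> carrier_vec n" "u' \<in> carrier_vec n"
      using u D by auto
    have idx: "u $ k + pair_vec n p $ k = u' $ k + pair_vec n p' $ k" if "k < n" for k
      using arg_cong[OF eq, of "\<lambda>v. v $ k"] that cu carrier[of p] carrier[of p'] by simp
    have "u = u'"
    proof (rule ccontr)
      assume "u \<noteq> u'"
      then have "5 \<le> hamming_distance u u'"
        using u dist by blast
      \<comment> \<open>Since the two sums agree, \<open>u\<close> and \<open>u'\<close> can differ
        only where one of the added words is nonzero.\<close>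
      also have "\<dots> \<le> card ({k. k < n \<and> pair_vec n p $ k \<noteq> 0} \<union> {k. k < n \<and> pair_vec n p' $ k \<noteq> 0})"
        unfolding hamming_distance_def using cu idx by (intro card_mono) (auto, metis add.right_neutral)
      also have "\<dots> \<le> 2 + 2"
        using two[OF p(1)] two[OF p(2)] by (intro order.trans[OF card_Un_le] add_mono)
      finally show False
        by simp
    qed
    moreover have "pair_vec n p = pair_vec n p'"
      using carrier[of p] carrier[of p'] idx \<open>u = u'\<close> by (intro eq_vecI) auto
    then have "p = p'"
      using p inj_on_pair_vec[of n] unfolding P_def by (auto dest!: inj_onD)
    ultimately show "u = u' \<and> p = p'"
      by simp
  qed
  then have "card (D \<times> P) \<le> card (carrier_vec n :: 'f vec set)"
    using D carrier by (intro card_inj_on_le finite_carrier_vec) auto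
  moreover have "2 * card P = n * (n - 1) * (CARD('f) - 1)\<^sup>2"
    using card_increasing_pairs[of n]
    by (simp add: P_def card_cartesian_product Compl_eq_Diff_UNIV card_Diff_singleton power2_eq_square)
  ultimately show ?thesis
    by (simp add: card_cartesian_product card_carrier_vec) (metis mult.left_commute mult_le_mono2)
qed

section \<open>Cyclic codes as multiples of the generator polynomial\<close>

lemma coeff_word_poly: "coeff (word_poly v) i = (if i < dim_vec v then v $ i else 0)"
  by (simp add: word_poly_def coeff_Poly nth_default_def)

lemma word_poly_add:
  fixes u v :: "'f::comm_ring_1 vec"
  assumes "u \<in> carrier_vec n" "v \<in> carrier_vec n"
  shows "word_poly (u + v) = word_poly u + word_poly v"
  using assms by (intro poly_eqI) (simp add: coeff_word_poly)

lemma word_poly_smult: "word_poly (c \<cdot>\<^sub>v v) = smult c (word_poly (v :: 'f::comm_ring_1 vec))"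
  by (intro poly_eqI) (simp add: coeff_word_poly)

lemma degree_word_poly_less:
  assumes "v \<in> carrier_vec n" "n > 0"
  shows "degree (word_poly v) < n"
proof -
  have "degree (word_poly v) \<le> n - 1"
    using assms by (intro degree_le) (auto simp: coeff_word_poly)
  then show ?thesis
    using assms by simp
qed

lemma word_poly_vec_coeff:
  assumes "degree p < n"
  shows "word_poly (vec n (coeff p)) = p"
  using assms by (intro poly_eqI) (auto simp: coeff_word_poly coeff_eq_0)

lemma bij_betw_word_poly:
  assumes "n > 0"
  shows "bij_betw word_poly (carrier_vec n :: 'f::comm_ring_1 vec set) {p. degree p < n}"
proof (rule bij_betw_byWitness[where f' = "\<lambda>p. vec n (coeff p)"])
  show "\<forall>v\<in>carrier_vec n. vec n (coeff (word_poly v)) = (v :: 'f vec)"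
    by (auto simp: coeff_word_poly intro!: eq_vecI)
qed (use assms in \<open>auto simp: word_poly_vec_coeff degree_word_poly_less\<close>)

lemma poly_word_poly:
  fixes v :: "'f::comm_ring_1 vec"
  assumes "v \<in> carrier_vec n"
  shows "poly (word_poly v) a = (\<Sum>i<n. v $ i * a ^ i)"
proof (cases "n = 0")
  case False
  then have "poly (word_poly v) a = (\<Sum>i<n. coeff (word_poly v) i * a ^ i)"
    using degree_word_poly_less[OF assms]
    by (subst poly_altdef, intro sum.mono_neutral_left) (auto simp: coeff_eq_0)
  then show ?thesis
    using assms by (simp add: coeff_word_poly)
next
  case True
  then have "word_poly v = 0"
    using assms by (intro poly_eqI) (simp add: coeff_word_poly)
  then show ?thesis
    using True by simp
qed

context
  fixes n :: nat and R :: "'f::field poly ring" and f :: "'f poly"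
  defines "R \<equiv> class_ring" and "f \<equiv> monom 1 n - 1"
begin

interpretation R: cring R
  unfolding R_def by (rule class_cring.is_cring)

lemma cyclic_modulus_eq: "cyclic_modulus n = {p. f dvd p}"
proof -
  have "cyclic_modulus n = PIdl\<^bsub>R\<^esub> f"
    unfolding cyclic_modulus_def R_def[symmetric] f_def[symmetric]
    by (rule R.cgenideal_eq_genideal[symmetric]) (simp add: R_def)
  then show ?thesis
    by (auto simp: cgenideal_def R_def dvd_def mult.commute)
qed

lemma ideal_cyclic_modulus: "ideal (cyclic_modulus n) R"
  unfolding cyclic_modulus_def R_def[symmetric]
  by (rule R.genideal_ideal) (simp add: R_def)

interpretation I: ideal "cyclic_modulus n" R
  by (rule ideal_cyclic_modulus)

interpretation Q: cring "cyclic_ring n :: 'f poly set ring"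
  using I.quotient_is_cring[OF R.is_cring] by (simp add: cyclic_ring_def R_def)

lemma residue_class_eq_iff: "residue_class n p = residue_class n q \<longleftrightarrow> f dvd p - q"
proof -
  have "p \<ominus>\<^bsub>R\<^esub> q = p - q"
    by (simp add: R_def class_ring_simps)
  then show ?thesis
    using R.quotient_eq_iff_same_a_r_cos[OF ideal_cyclic_modulus, of p q]
    by (simp add: residue_class_def cyclic_modulus_eq R_def)
qed

lemma carrier_cyclic_ring: "carrier (cyclic_ring n) = range (residue_class n :: 'f poly \<Rightarrow> _)"
  by (auto simp: cyclic_ring_def FactRing_def A_RCOSETS_def' residue_class_def)

lemma residue_class_mult:
  fixes p q :: "'f poly"
  shows "residue_class n p \<otimes>\<^bsub>cyclic_ring n\<^esub> residue_class n q = residue_class n (p * q)"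
  using I.rcoset_mult_add[of p q] by (simp add: cyclic_ring_def FactRing_def residue_class_def R_def)

lemma genideal_residue_class:
  fixes g :: "'f poly"
  shows "Idl\<^bsub>cyclic_ring n\<^esub> {residue_class n g} = (\<lambda>p. residue_class n (p * g)) ` UNIV"
proof -
  have "Idl\<^bsub>cyclic_ring n\<^esub> {residue_class n g} = PIdl\<^bsub>cyclic_ring n\<^esub> (residue_class n g)"
    by (rule Q.cgenideal_eq_genideal[symmetric]) (simp add: carrier_cyclic_ring)
  also have "\<dots> = (\<lambda>x. x \<otimes>\<^bsub>cyclic_ring n\<^esub> residue_class n g) ` range (residue_class n)"
    by (auto simp: cgenideal_def carrier_cyclic_ring)
  finally show ?thesis
    by (simp add: image_image residue_class_mult)
qed

text \<open>Because \<open>g\<close> divides \<open>f\<close>, congruence modulo \<open>f\<close>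
  respects divisibility by \<open>g\<close>.\<close>

lemma residue_class_in_genideal_iff:
  fixes g :: "'f poly"
  assumes "g dvd f"
  shows "residue_class n p \<in> Idl\<^bsub>cyclic_ring n\<^esub> {residue_class n g} \<longleftrightarrow> g dvd p"
proof
  assume "residue_class n p \<in> Idl\<^bsub>cyclic_ring n\<^esub> {residue_class n g}"
  then obtain q where "f dvd p - q * g"
    by (auto simp: genideal_residue_class residue_class_eq_iff)
  then have "g dvd (p - q * g) + q * g"
    using assms by (intro dvd_add dvd_triv_right) (rule dvd_trans)
  then show "g dvd p"
    by simp
next
  assume "g dvd p"
  then obtain q where "p = q * g"
    by (metis dvd_def mult.commute)
  then show "residue_class n p \<in> Idl\<^bsub>cyclic_ring n\<^esub> {residue_class n g}"
    by (auto simp: genideal_residue_class)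
qed

lemma degree_x_power_minus_1:
  assumes "n > 0"
  shows "degree f = n"
proof -
  have "degree (monom 1 n + (- 1 :: 'f poly)) = degree (monom (1::'f) n)"
    using assms by (intro degree_add_eq_left) (simp add: degree_monom_eq)
  then show ?thesis
    by (simp add: f_def degree_monom_eq)
qed

lemma inj_on_residue_class_word_poly:
  assumes "n > 0"
  shows "inj_on (\<lambda>v. residue_class n (word_poly v :: 'f poly)) (carrier_vec n)"
proof (rule inj_onI)
  fix u v :: "'f vec"
  assume u: "u \<in> carrier_vec n" and v: "v \<in> carrier_vec n"
    and "residue_class n (word_poly u) = residue_class n (word_poly v)"
  then have "f dvd word_poly u - word_poly v"
    by (simp add: residue_class_eq_iff)
  moreover have "degree (word_poly u - word_poly v) < n"
    using u v assms by (intro degree_diff_less degree_word_poly_less)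
  ultimately have "word_poly u - word_poly v = 0"
    using dvd_imp_degree_le[of f "word_poly u - word_poly v"] degree_x_power_minus_1[OF assms] by linarith
  then show "u = v"
    using bij_betw_word_poly[OF assms] u v by (auto simp: bij_betw_def dest: inj_onD)
qed

lemma code_ideal_multiples:
  assumes n: "n > 0" and g: "g dvd f"
  shows "code_ideal n {v \<in> carrier_vec n. g dvd word_poly v} = Idl\<^bsub>cyclic_ring n\<^esub> {residue_class n g}"
proof (intro equalityI subsetI)
  fix x
  assume "x \<in> code_ideal n {v \<in> carrier_vec n. g dvd word_poly v}"
  then show "x \<in> Idl\<^bsub>cyclic_ring n\<^esub> {residue_class n g}"
    using g by (auto simp: code_ideal_def residue_class_in_genideal_iff)
next
  fix x
  assume "x \<in> Idl\<^bsub>cyclic_ring n\<^esub> {residue_class n g}"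
  then obtain p where x: "x = residue_class n (p * g)"
    by (auto simp: genideal_residue_class)
  \<comment> \<open>The remainder is the representative of degree below \<open>n\<close>, and
    \<open>g\<close> still divides it because \<open>g\<close> divides \<open>f\<close>.\<close>
  define r where "r = (p * g) mod f"
  define v where "v = vec n (coeff r)"
  note deg = degree_x_power_minus_1[OF n]
  then have "f \<noteq> 0"
    using n by auto
  then have "degree r < n"
    using degree_mod_less'[of f "p * g"] deg n unfolding r_def by (cases "(p * g) mod f = 0") auto
  then have v: "word_poly v = r" "v \<in> carrier_vec n"
    by (simp_all add: v_def word_poly_vec_coeff)
  moreover have "g dvd r"
    using g by (simp add: r_def dvd_mod)
  moreover have "residue_class n r = x"
    unfolding x residue_class_eq_iff r_def by (simp add: dvd_diff_commute flip: minus_mod_eq_mult_div)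
  ultimately show "x \<in> code_ideal n {v \<in> carrier_vec n. g dvd word_poly v}"
    by (auto simp: code_ideal_def)
qed

text \<open>Any monic \<open>h\<close> generating the same ideal is a multiple of \<open>g\<close>,
  so \<open>g\<close> has least degree. The code is unique because the map from words to residue
  classes is injective.\<close>

lemma cyclic_code_of_eq:
  assumes n: "n > 0" and g: "g dvd f" and monic: "lead_coeff g = 1"
  shows "cyclic_code_of n g = {v \<in> carrier_vec n. g dvd word_poly v}"
  unfolding cyclic_code_of_def
proof (rule the_equality)
  let ?C = "{v \<in> carrier_vec n. g dvd word_poly v}"
  have gen: "code_ideal n ?C = Idl\<^bsub>cyclic_ring n\<^esub> {residue_class n g}"
    by (rule code_ideal_multiples[OF n g])
  have "ideal (Idl\<^bsub>cyclic_ring n\<^esub> {residue_class n g}) (cyclic_ring n)"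
    by (rule Q.genideal_ideal) (auto simp: carrier_cyclic_ring)
  moreover have "degree g \<le> degree h"
    if "lead_coeff h = 1" "Idl\<^bsub>cyclic_ring n\<^esub> {residue_class n g} = Idl\<^bsub>cyclic_ring n\<^esub> {residue_class n h}" for h
  proof -
    have "residue_class n h \<in> Idl\<^bsub>cyclic_ring n\<^esub> {residue_class n h}"
      by (rule Q.genideal_self') (auto simp: carrier_cyclic_ring)
    then have "g dvd h"
      using that(2) residue_class_in_genideal_iff[OF g] by metis
    then show ?thesis
      using that(1) by (intro dvd_imp_degree_le) auto
  qed
  ultimately show "cyclic_code n ?C \<and> generator_polynomial n ?C g"
    using monic by (auto simp: cyclic_code_def generator_polynomial_def generates_code_def gen)
  fix C :: "'f vec set"
  assume C: "cyclic_code n C \<and> generator_polynomial n C g"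
  then have "code_ideal n C = code_ideal n ?C"
    by (simp add: generator_polynomial_def generates_code_def gen)
  then show "C = ?C"
    unfolding code_ideal_def using C
    by (subst (asm) inj_on_image_eq_iff[OF inj_on_residue_class_word_poly[OF n]])
       (auto simp: cyclic_code_def)
qed

end

text \<open>Multiplication by \<open>g\<close> is a bijection from the polynomials of degree less than \<open>n - deg g\<close>
  onto the code polynomials.\<close>

lemma card_multiples:
  fixes g :: "'f::{field,finite} poly"
  assumes g: "g \<noteq> 0" and n: "degree g < n"
  shows "card {v \<in> carrier_vec n. g dvd word_poly v} = CARD('f) ^ (n - degree g)"
proof -
  have bij1: "bij_betw word_poly {v \<in> carrier_vec n. g dvd word_poly v} {p. degree p < n \<and> g dvd p}"
  proof (rule bij_betw_imageI)
    have bij: "bij_betw word_poly (carrier_vec n :: 'f vec set) {p. degree p < n}"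
      using n by (intro bij_betw_word_poly) simp
    then show "inj_on word_poly {v \<in> carrier_vec n. g dvd word_poly v}"
      by (auto simp: bij_betw_def inj_on_def)
    have "word_poly ` {v \<in> carrier_vec n. g dvd word_poly v} =
        word_poly ` carrier_vec n \<inter> {p. g dvd p}"
      by blast
    then show "word_poly ` {v \<in> carrier_vec n. g dvd word_poly v} = {p. degree p < n \<and> g dvd p}"
      using bij by (auto simp: bij_betw_def)
  qed
  have bij2: "bij_betw ((*) g) {p. degree p < n - degree g} {p. degree p < n \<and> g dvd p}"
  proof (rule bij_betw_imageI)
    show "inj_on ((*) g) {p. degree p < n - degree g}"
      using g by (auto intro: inj_onI)
    show "(*) g ` {p. degree p < n - degree g} = {p. degree p < n \<and> g dvd p}"
    proof (intro equalityI subsetI)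
      fix p
      assume "p \<in> {p. degree p < n \<and> g dvd p}"
      then obtain q where q: "p = g * q" "degree (g * q) < n"
        by (auto simp: dvd_def)
      then have "degree q < n - degree g"
        using g n by (cases "q = 0") (auto simp: degree_mult_eq)
      then show "p \<in> (*) g ` {p. degree p < n - degree g}"
        using q(1) by (intro image_eqI[of _ _ q]) auto
    next
      fix p
      assume "p \<in> (*) g ` {p. degree p < n - degree g}"
      then obtain q where q: "p = g * q" "degree q < n - degree g"
        by auto
      then have "degree p < n"
        using degree_mult_le[of g q] by simp
      then show "p \<in> {p. degree p < n \<and> g dvd p}"
        using q by simp
    qed
  qed
  have bij3: "bij_betw word_poly (carrier_vec (n - degree g) :: 'f vec set) {p. degree p < n - degree g}"
    using n by (intro bij_betw_word_poly) simp
  show ?thesis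
    using bij_betw_same_card[OF bij1] bij_betw_same_card[OF bij2] bij_betw_same_card[OF bij3]
    by (simp add: card_carrier_vec)
qed

lemma linear_code_multiples:
  "linear_code n {v \<in> carrier_vec n. (g :: 'f::field poly) dvd word_poly v}"
proof -
  have "word_poly (0\<^sub>v n) = (0 :: 'f poly)"
    by (intro poly_eqI) (simp add: coeff_word_poly)
  then show ?thesis
    by (auto simp: linear_code_iff word_poly_add word_poly_smult dvd_smult)
qed

section \<open>Minimal polynomials over the field with three elements\<close>

text \<open>Multiplication by \<open>x\<close> permutes the nonzero elements; their product is
  compared before and after.\<close>

lemma finite_field_power_card_minus_1:
  fixes x :: "'a::{field,finite}"
  assumes "x \<noteq> 0"
  shows "x ^ (CARD('a) - 1) = 1"
proof -
  have bij: "bij_betw ((*) x) (UNIV - {0}) (UNIV - {0})"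
    by (rule bij_betw_byWitness[where f' = "(*) (inverse x)"]) (use assms in auto)
  have "(\<Prod>y\<in>UNIV - {0}. y) = (\<Prod>y\<in>UNIV - {0}. x * y)"
    by (rule prod.reindex_bij_betw[OF bij, symmetric])
  also have "\<dots> = x ^ (CARD('a) - 1) * (\<Prod>y\<in>UNIV - {0}. y)"
    by (simp add: prod.distrib card_Diff_singleton)
  finally show ?thesis
    by simp
qed

text \<open>If 1 and -1 coincided, a third element \<open>a\<close> would bring a fourth one,
  \<open>a + 1\<close>. Hence 0, 1, -1 exhaust the field, and 2 can only be -1.\<close>

lemma card_3_field_elements:
  fixes c :: "'f::{field,finite}"
  assumes "CARD('f) = 3"
  shows "c \<in> {0, 1, - 1}" and "(3::'f) = 0"
proof -
  have ne: "(1::'f) \<noteq> - 1"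
  proof
    assume eq: "(1::'f) = - 1"
    have "UNIV \<noteq> {0, 1::'f}"
      using assms by (metis card_2_iff numeral_eq_iff semiring_norm(89) zero_neq_one)
    then obtain a :: 'f where a: "a \<noteq> 0" "a \<noteq> 1"
      by auto
    have "a + 1 \<notin> {0, 1, a}"
      using a eq by (auto simp: add_eq_0_iff2)
    then have "card {0, 1, a, a + 1} = 4"
      using a by auto
    moreover have "card {0, 1, a, a + 1} \<le> CARD('f)"
      by (intro card_mono) auto
    ultimately show False
      using assms by simp
  qed
  then have "card {0, 1, - 1 :: 'f} = 3"
    by auto
  then have univ: "{0, 1, - 1} = (UNIV :: 'f set)"
    using assms by (intro card_subset_eq) auto
  then show "c \<in> {0, 1, - 1}"
    by simp
  have "(2::'f) \<in> {0, 1, - 1}"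
    unfolding univ by simp
  moreover have "(2::'f) \<noteq> 0"
    using ne by (metis add.inverse_unique one_add_one)
  moreover have "(2::'f) \<noteq> 1"
    by (metis add_cancel_right_right one_add_one zero_neq_one)
  ultimately have "(2::'f) + 1 = 0"
    by (metis add.left_inverse insertE singletonD)
  then show "(3::'f) = 0"
    by simp
qed

locale ternary_field_extension = field_hom \<iota>
  for \<iota> :: "'f::{field,finite} \<Rightarrow> 'k::{field,finite}" +
  fixes m :: nat
  assumes card_base: "CARD('f) = 3" and card_ext: "CARD('k) = 3 ^ m" and m_pos: "m > 0"
begin

sublocale map_poly: map_poly_inj_idom_hom \<iota> ..

definition eval :: "'f poly \<Rightarrow> 'k \<Rightarrow> 'k" where
  "eval p x = poly (map_poly \<iota> p) x"

lemma eval_monom_minus_1: "eval (monom 1 n - 1) x = x ^ n - 1"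
  by (simp add: eval_def map_poly.hom_minus map_poly_monom poly_monom)

lemma eval_add: "eval (p + q) x = eval p x + eval q x"
  by (simp add: eval_def map_poly.hom_add)

lemma eval_diff: "eval (p - q) x = eval p x - eval q x"
  by (simp add: eval_def map_poly.hom_minus)

lemma eval_mult: "eval (p * q) x = eval p x * eval q x"
  by (simp add: eval_def map_poly.hom_mult)

lemma eval_smult: "eval (smult c p) x = \<iota> c * eval p x"
  by (simp add: eval_def map_poly_hom_smult)

lemma eval_altdef: "eval p x = (\<Sum>i\<le>degree p. \<iota> (coeff p i) * x ^ i)"
  by (simp add: eval_def poly_altdef)

lemma card_roots_le_degree:
  assumes "p \<noteq> 0" and "\<And>x. x \<in> A \<Longrightarrow> eval p x = 0"
  shows "card A \<le> degree p"
proof -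
  have "card A \<le> card {x. poly (map_poly \<iota> p) x = 0}"
    using assms(2) by (intro card_mono) (auto simp: eval_def)
  also have "\<dots> \<le> degree (map_poly \<iota> p)"
    using assms(1) by (intro card_poly_roots_bound) simp
  finally show ?thesis
    by simp
qed

lemma three_ext: "(3::'k) = 0"
proof -
  have "\<iota> (1 + 1 + 1) = 1 + 1 + 1"
    by (simp only: hom_add hom_one)
  then show ?thesis
    using card_3_field_elements(2)[OF card_base] by simp
qed

lemma power_card_ext: "(x::'k) ^ 3 ^ m = x"
proof (cases "x = 0")
  case False
  have "x ^ 3 ^ m = x ^ (CARD('k) - 1) * x"
    using m_pos by (simp add: card_ext flip: power_Suc2)
  then show ?thesis
    using finite_field_power_card_minus_1[OF False] by simp
qed (use m_pos in simp)

text \<open>Frobenius fixes the coefficients. Hence the conjugates of a zero are zeros.\<close>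

lemma eval_frobenius: "eval p (x ^ 3 ^ k) = eval p x ^ 3 ^ k"
proof -
  have "\<iota> c ^ 3 ^ k = \<iota> c" for c
    using card_3_field_elements(1)[OF card_base, of c] by (auto simp: hom_uminus frobenius_minus)
  then show ?thesis
    by (simp add: eval_altdef frobenius_sum[OF three_ext] power_mult_distrib)
       (simp add: mult.commute flip: power_mult)
qed

lemma monic_scaling:
  assumes "p \<noteq> 0" "eval p x = 0"
  shows "lead_coeff (smult (inverse (lead_coeff p)) p) = 1"
    "eval (smult (inverse (lead_coeff p)) p) x = 0"
    "degree (smult (inverse (lead_coeff p)) p) = degree p"
  using assms by (simp_all add: eval_smult)

text \<open>Pigeonhole: \<open>3 ^ (m + 1)\<close> polynomials of degree at most \<open>m\<close>
  take at most \<open>3 ^ m\<close> values at \<open>x\<close>, so the difference of two of them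
  vanishes there.\<close>

lemma exists_annihilating_poly: "\<exists>p. p \<noteq> 0 \<and> eval p x = 0 \<and> degree p \<le> m"
proof -
  define E where "E v = eval (word_poly v) x" for v
  have "card (carrier_vec (Suc m) :: 'f vec set) = 3 ^ Suc m"
    by (simp add: card_carrier_vec card_base)
  moreover have "card (E ` carrier_vec (Suc m)) \<le> CARD('k)"
    by (intro card_mono) auto
  ultimately have "\<not> inj_on E (carrier_vec (Suc m))"
    using card_image[of E "carrier_vec (Suc m)"] card_ext by auto
  then obtain u v where uv: "u \<in> carrier_vec (Suc m)" "v \<in> carrier_vec (Suc m)" "u \<noteq> v" "E u = E v"
    by (auto simp: inj_on_def)
  have "word_poly u \<noteq> word_poly v"
    using bij_betw_word_poly[where 'f = 'f and n = "Suc m"] uv by (auto simp: bij_betw_def dest: inj_onD)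
  moreover have "degree (word_poly u - word_poly v) < Suc m"
    using uv by (intro degree_diff_less degree_word_poly_less) auto
  ultimately show ?thesis
    using uv by (intro exI[of _ "word_poly u - word_poly v"]) (auto simp: E_def eval_diff)
qed

text \<open>The \<open>THE\<close> in the definition denotes something: a monic annihilator of least
  degree exists, and the difference of two such would, once scaled, be a monic annihilator of
  smaller degree.\<close>

lemma minimal_polynomial:
  shows "lead_coeff (minimal_polynomial \<iota> x) = 1" and "eval (minimal_polynomial \<iota> x) x = 0"
    and "degree (minimal_polynomial \<iota> x) \<le> m"
proof -
  define P where "P p \<longleftrightarrow> lead_coeff p = 1 \<and> eval p x = 0" for p
  have ex: "\<exists>q. P q \<and> degree q = degree p" if "p \<noteq> 0" "eval p x = 0" for p
    using monic_scaling[OF that] unfolding P_def by blast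
  obtain p0 where p0: "P p0" "degree p0 \<le> m"
    using exists_annihilating_poly[of x] ex by metis
  define p where "p = arg_min degree P"
  have p: "P p" and min: "degree p \<le> degree q" if "P q" for q
    unfolding p_def using p0(1) that by (auto intro: arg_min_natI arg_min_nat_le)
  have "minimal_polynomial \<iota> x = p"
    unfolding minimal_polynomial_def eval_def[symmetric]
  proof (rule the_equality)
    show "lead_coeff p = 1 \<and> eval p x = 0 \<and>
        (\<forall>q. lead_coeff q = 1 \<and> eval q x = 0 \<longrightarrow> degree p \<le> degree q)"
      using p[OF p0(1)] min by (auto simp: P_def)
    fix r
    assume r: "lead_coeff r = 1 \<and> eval r x = 0 \<and>
        (\<forall>q. lead_coeff q = 1 \<and> eval q x = 0 \<longrightarrow> degree r \<le> degree q)"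
    then have "P r" and deg: "degree r = degree p"
      using p[OF p0(1)] min[of r] by (auto simp: P_def)
    show "r = p"
    proof (rule ccontr)
      assume "r \<noteq> p"
      then obtain q where q: "P q" "degree q = degree (r - p)"
        using ex[of "r - p"] \<open>P r\<close> p[OF p0(1)] by (auto simp: P_def eval_diff)
      have "coeff (r - p) (degree p) = 0"
        using \<open>P r\<close> p[OF p0(1)] deg by (auto simp: P_def)
      moreover have "degree (r - p) \<le> degree p"
        using deg by (intro degree_diff_le) auto
      ultimately have "degree (r - p) < degree p"
        using \<open>r \<noteq> p\<close> by (metis leading_coeff_0_iff right_minus_eq le_neq_implies_less)
      then show False
        using min[OF q(1)] q(2) by simp
    qed
  qed
  then show "lead_coeff (minimal_polynomial \<iota> x) = 1" "eval (minimal_polynomial \<iota> x) x = 0"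
    "degree (minimal_polynomial \<iota> x) \<le> m"
    using p[OF p0(1)] min[OF p0(1)] p0(2) by (auto simp: P_def)
qed

text \<open>If the conjugates with indices \<open>i < j\<close> coincide, the power
  \<open>3 ^ (m - i)\<close> takes the first back to \<open>x\<close> and the second to
  \<open>x ^ 3 ^ (j - i)\<close>.\<close>

lemma inj_on_conjugates:
  fixes x :: 'k
  assumes "\<And>k. 0 < k \<Longrightarrow> k < m \<Longrightarrow> x ^ 3 ^ k \<noteq> x"
  shows "inj_on (\<lambda>j. x ^ 3 ^ j) {..<m}"
proof -
  have "x ^ 3 ^ i \<noteq> x ^ 3 ^ j" if "i < j" "j < m" for i j
  proof
    assume "x ^ 3 ^ i = x ^ 3 ^ j"
    then have "(x ^ 3 ^ i) ^ 3 ^ (m - i) = (x ^ 3 ^ j) ^ 3 ^ (m - i)"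
      by simp
    also have "\<dots> = x ^ 3 ^ (m + (j - i))"
      using that by (simp add: add.commute[of j m] flip: power_mult power_add)
    also have "\<dots> = x ^ 3 ^ (j - i)"
      by (simp only: power_add power_mult power_card_ext)
    finally have "x = x ^ 3 ^ (j - i)"
      using that by (simp add: power_card_ext flip: power_mult power_add)
    moreover have "0 < j - i" "j - i < m"
      using that by linarith+
    ultimately show False
      using assms[of "j - i"] by simp
  qed
  then show ?thesis
    by (intro inj_onI) (metis lessThan_iff nat_neq_iff)
qed

text \<open>The \<open>m\<close> distinct conjugates are zeros, which meets the upper bound
  \<open>m\<close>.\<close>

lemma degree_minimal_polynomial:
  assumes "\<And>k. 0 < k \<Longrightarrow> k < m \<Longrightarrow> x ^ 3 ^ k \<noteq> x"
  shows "degree (minimal_polynomial \<iota> x) = m"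
proof (rule antisym)
  have "card ((\<lambda>j. x ^ 3 ^ j) ` {..<m}) \<le> degree (minimal_polynomial \<iota> x)"
    using minimal_polynomial[of x] by (intro card_roots_le_degree) (auto simp: eval_frobenius)
  then show "m \<le> degree (minimal_polynomial \<iota> x)"
    by (simp add: card_image[OF inj_on_conjugates[OF assms]])
qed (rule minimal_polynomial)

text \<open>The remainder of \<open>p\<close> modulo the product vanishes at all \<open>2 * m\<close> conjugates of \<open>x\<close> and \<open>y\<close>.\<close>

lemma minimal_polynomial_mult_dvd_iff:
  assumes x: "\<And>k. 0 < k \<Longrightarrow> k < m \<Longrightarrow> x ^ 3 ^ k \<noteq> x"
    and y: "\<And>k. 0 < k \<Longrightarrow> k < m \<Longrightarrow> y ^ 3 ^ k \<noteq> y"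
    and xy: "\<And>i j. x ^ 3 ^ i \<noteq> y ^ 3 ^ j"
  shows "minimal_polynomial \<iota> x * minimal_polynomial \<iota> y dvd p \<longleftrightarrow> eval p x = 0 \<and> eval p y = 0"
proof
  assume "minimal_polynomial \<iota> x * minimal_polynomial \<iota> y dvd p"
  then show "eval p x = 0 \<and> eval p y = 0"
    using minimal_polynomial(2) by (auto simp: dvd_def eval_mult)
next
  define g where "g = minimal_polynomial \<iota> x * minimal_polynomial \<iota> y"
  define A where "A = (\<lambda>j. x ^ 3 ^ j) ` {..<m} \<union> (\<lambda>j. y ^ 3 ^ j) ` {..<m}"
  assume 0: "eval p x = 0 \<and> eval p y = 0"
  have nz: "minimal_polynomial \<iota> z \<noteq> 0" for z
    using minimal_polynomial(1)[of z] by auto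
  have deg: "degree g = 2 * m"
    using nz degree_minimal_polynomial[OF x] degree_minimal_polynomial[OF y]
    by (simp add: g_def degree_mult_eq)
  have "card A = 2 * m"
    unfolding A_def using xy
    by (subst card_Un_disjoint)
       (auto simp: card_image[OF inj_on_conjugates[OF x]] card_image[OF inj_on_conjugates[OF y]])
  have "p mod g = 0"
  proof (rule ccontr)
    assume "p mod g \<noteq> 0"
    have "eval p z = eval (p mod g) z" if "z \<in> {x, y}" for z
    proof -
      have "eval p z = eval (p div g * g + p mod g) z"
        by simp
      also have "\<dots> = eval (p mod g) z"
        using that minimal_polynomial(2) by (auto simp: eval_add eval_mult g_def simp del: div_mult_mod_eq)
      finally show ?thesis .
    qed
    then have "card A \<le> degree (p mod g)"
      using 0 \<open>p mod g \<noteq> 0\<close> by (intro card_roots_le_degree) (auto simp: A_def eval_frobenius)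
    moreover have "degree (p mod g) < degree g"
      using degree_mod_less[of g p] \<open>p mod g \<noteq> 0\<close> nz by (auto simp: g_def)
    ultimately show False
      using deg \<open>card A = 2 * m\<close> by simp
  qed
  then show "minimal_polynomial \<iota> x * minimal_polynomial \<iota> y dvd p"
    by (simp add: g_def dvd_eq_mod_eq_0)
qed

lemma eval_word_poly:
  assumes "v \<in> carrier_vec n"
  shows "eval (word_poly v) x = (\<Sum>i<n. \<iota> (v $ i) * x ^ i)"
proof -
  have "map_poly \<iota> (word_poly v) = word_poly (map_vec \<iota> v)"
    by (intro poly_eqI) (simp add: coeff_word_poly)
  then show ?thesis
    using poly_word_poly[of "map_vec \<iota> v" n x] assms by (simp add: eval_def)
qed

text \<open>The powers with exponents below \<open>3 ^ m - 1\<close> cover all nonzero elements,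
  which are equally many, so these powers are distinct.\<close>

lemma power_primitive_element_eq_iff:
  assumes "primitive_element (\<alpha> :: 'k)"
  shows "\<alpha> ^ a = \<alpha> ^ b \<longleftrightarrow> [a = b] (mod (3 ^ m - 1))"
proof -
  define n :: nat where "n = 3 ^ m - 1"
  have "\<alpha> powi 1 \<noteq> 0"
    using assms unfolding primitive_element_def by blast
  then have nz: "\<alpha> \<noteq> 0"
    by simp
  have n1: "\<alpha> ^ n = 1"
    using finite_field_power_card_minus_1[OF nz] by (simp add: n_def card_ext)
  have "(3::nat) ^ 1 \<le> 3 ^ m"
    using m_pos by (intro power_increasing) auto
  then have n_pos: "n > 0"
    by (simp add: n_def)
  have red: "\<alpha> ^ a = \<alpha> ^ (a mod n)" for a
  proof -
    have "\<alpha> ^ a = \<alpha> ^ (n * (a div n) + a mod n)"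
      by simp
    then show ?thesis
      by (simp only: power_add power_mult n1 power_one mult_1)
  qed
  have "UNIV - {0} \<subseteq> (\<lambda>i. \<alpha> ^ i) ` {..<n}"
  proof
    fix z :: 'k
    assume "z \<in> UNIV - {0}"
    then obtain i :: int where z: "z = \<alpha> powi i"
      using assms unfolding primitive_element_def by blast
    have "\<alpha> powi i = \<alpha> powi (int n * (i div int n) + i mod int n)"
      by simp
    also have "\<dots> = \<alpha> powi (i mod int n)"
      by (subst power_int_add) (use nz n1 in \<open>simp_all add: power_int_mult\<close>)
    also have "\<dots> = \<alpha> ^ nat (i mod int n)"
      using n_pos by (simp add: power_int_def)
    finally show "z \<in> (\<lambda>i. \<alpha> ^ i) ` {..<n}"
      using n_pos z by (auto simp: nat_less_iff)
  qed
  then have "card (UNIV - {0 :: 'k}) \<le> card ((\<lambda>i. \<alpha> ^ i) ` {..<n})"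
    by (intro card_mono) auto
  then have "n \<le> card ((\<lambda>i. \<alpha> ^ i) ` {..<n})"
    by (simp add: card_Diff_singleton card_ext n_def)
  then have "card ((\<lambda>i. \<alpha> ^ i) ` {..<n}) = card {..<n}"
    using card_image_le[of "{..<n}" "\<lambda>i. \<alpha> ^ i"] by simp
  then have inj: "inj_on (\<lambda>i. \<alpha> ^ i) {..<n}"
    by (rule eq_card_imp_inj_on[rotated]) simp
  have "\<alpha> ^ a = \<alpha> ^ b \<longleftrightarrow> \<alpha> ^ (a mod n) = \<alpha> ^ (b mod n)"
    using red[of a] red[of b] by simp
  also have "\<dots> \<longleftrightarrow> a mod n = b mod n"
    using inj n_pos by (auto dest: inj_onD)
  finally show ?thesis
    by (simp add: cong_def n_def)
qed

end

section \<open>Parameters of the code\<close>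

text \<open>For \<open>m = 4 * k + 3\<close> the power of 3 is \<open>27 * 9 ^ k\<close> with
  \<open>9 ^ k\<close> congruent to 1 modulo 4, so adding 5 gives a multiple of 4.\<close>

lemma exponent_properties:
  fixes m :: nat
  defines "e \<equiv> (3 ^ ((m + 3) div 2) + 5) div 2 :: nat"
  assumes m: "[m = 3] (mod 4)"
  shows "odd m" and "2 * e = 3 ^ ((m + 3) div 2) + 5" and "even e"
proof -
  have "m mod 4 = 3"
    using m by (simp add: cong_def)
  then have "m = 4 * (m div 4) + 3"
    using mult_div_mod_eq[of 4 m] by presburger
  then obtain k where k: "m = 4 * k + 3"
    by blast
  have "[9 ^ k = 1 ^ k] (mod (4::nat))"
    by (intro cong_pow) (simp add: cong_def)
  then have "9 ^ k mod 4 = (1::nat)"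
    by (simp add: cong_def)
  then have "9 ^ k = 4 * (9 ^ k div 4) + (1::nat)"
    using mult_div_mod_eq[of 4 "9 ^ k :: nat"] by presburger
  then obtain l :: nat where l: "9 ^ k = 4 * l + (1::nat)"
    by blast
  have "(m + 3) div 2 = 2 * k + 3"
    by (simp add: k)
  then have "(3::nat) ^ ((m + 3) div 2) = 27 * 9 ^ k"
    by (simp add: power_add power_mult)
  then have "(3::nat) ^ ((m + 3) div 2) + 5 = 2 * (2 * (27 * l + 8))"
    by (simp add: l)
  then show "2 * e = 3 ^ ((m + 3) div 2) + 5" "even e"
    unfolding e_def by simp_all
  show "odd m"
    by (simp add: k)
qed

context ternary_field_extension
begin

text \<open>A conjugate relation \<open>x ^ 3 ^ k = x\<close> puts \<open>x\<close> into a proper subfield, whose degree is at most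
  \<open>m / 5\<close>. The bound on \<open>e\<close> makes this impossible for \<open>x = \<alpha> ^ e\<close>.\<close>

lemma conjugates_of_power:
  fixes \<alpha> :: 'k and e :: nat
  assumes \<alpha>: "primitive_element \<alpha>" and m: "coprime 2 m" "coprime 3 m"
    and e: "2 * e = 3 ^ ((m + 3) div 2) + 5" and k: "0 < k" "k < m"
  shows "(\<alpha> ^ e) ^ 3 ^ k \<noteq> \<alpha> ^ e"
proof
  define h where "h = (m + 3) div 2"
  define d where "d = gcd k m"
  assume "(\<alpha> ^ e) ^ 3 ^ k = \<alpha> ^ e"
  then have "(\<alpha> ^ e) ^ 3 ^ d = \<alpha> ^ e"
    unfolding d_def by (intro frobenius_fixed_gcd power_card_ext)
  then have "\<alpha> ^ (e * 3 ^ d) = \<alpha> ^ e"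
    by (simp add: power_mult)
  then have cong: "[e * 3 ^ d = e] (mod (3 ^ m - 1))"
    by (simp add: power_primitive_element_eq_iff[OF \<alpha>])
  have d: "d > 0" "d \<le> k" "d dvd m"
    using k by (auto simp: d_def intro: dvd_imp_le)
  then obtain c where c: "m = d * c"
    by blast
  \<comment> \<open>The cofactor \<open>c\<close> is prime to 6 and, since \<open>d < m\<close>,
    different from 1; hence it is at least 5.\<close>
  have "coprime 2 c" "coprime 3 c"
    using m by (auto simp: c)
  moreover have "c \<noteq> 0"
    using c k by (cases "c = 0") simp_all
  moreover have "c \<noteq> 1"
    using c k d by auto
  ultimately have "c \<noteq> 0" "c \<noteq> 1" "c \<noteq> 2" "c \<noteq> 3" "c \<noteq> 4"
    by (auto simp: coprime_left_2_iff_odd)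
  then have "5 * d \<le> m"
    unfolding c by (simp add: mult.commute)
  then have hd: "h + d \<le> m" "h \<ge> 2"
    using d by (auto simp: h_def)
  have "(3::nat) ^ 2 \<le> 3 ^ h" "(3::nat) ^ 1 \<le> 3 ^ d"
    using hd d power_increasing[of 2 h "3::nat"] power_increasing[of 1 d "3::nat"] by auto
  then have h9: "(9::nat) \<le> 3 ^ h" and d3: "(3::nat) \<le> 3 ^ d"
    by simp_all
  \<comment> \<open>By \<open>3 ^ h + 5 \<le> 2 * 3 ^ h\<close> and \<open>h + d \<le> m\<close>,
    the exponent difference \<open>e * (3 ^ d - 1)\<close> stays below the order
    \<open>3 ^ m - 1\<close> of \<open>\<alpha>\<close>.\<close>
  have "2 * (e * (3 ^ d - 1)) = (3 ^ h + 5) * (3 ^ d - 1)"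
    using e by (simp add: h_def)
  also have "\<dots> \<le> (2 * 3 ^ h) * (3 ^ d - 1)"
    using h9 by (intro mult_right_mono) auto
  also have "\<dots> = 2 * 3 ^ (h + d) - 2 * 3 ^ h"
    by (simp add: power_add diff_mult_distrib2)
  also have "\<dots> \<le> 2 * 3 ^ m - 2 * 3 ^ h"
    using hd by (intro diff_le_mono mult_left_mono power_increasing) auto
  also have "\<dots> < 2 * (3 ^ m - 1)"
  proof -
    have "(3::nat) ^ h \<le> 3 ^ m"
      using hd by (intro power_increasing) auto
    then show ?thesis
      using h9 by linarith
  qed
  finally have less: "e * (3 ^ d - 1) < 3 ^ m - 1"
    by simp
  have "e * 3 ^ d = e + e * (3 ^ d - 1)"
    using d3 by (simp add: diff_mult_distrib2)
  then have "[e + e * (3 ^ d - 1) = e + 0] (mod (3 ^ m - 1))"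
    using cong by simp
  then have "[e * (3 ^ d - 1) = 0] (mod (3 ^ m - 1))"
    by (simp only: cong_add_lcancel_nat)
  then have "3 ^ m - 1 dvd e * (3 ^ d - 1)"
    by (simp add: cong_0_iff)
  moreover have "e * (3 ^ d - 1) > 0"
    using e d3 by simp
  ultimately show False
    using less dvd_imp_le by (metis not_less)
qed

end

text \<open>The weight-2 words already exceed the bound \<open>9 ^ m = (n + 1)\<^sup>2\<close>, since \<open>n \<ge> 8\<close>.\<close>

lemma min_distance_le_4:
  fixes D :: "'f::{field,finite} vec set" and m :: nat
  defines "n \<equiv> 3 ^ m - 1"
  assumes card: "CARD('f) = 3" and m: "m \<ge> 2" and D: "linear_code n D" "code_dim n D = n - 2 * m"
    and le: "2 * m < n"
  shows "min_distance D \<le> 4"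
proof (rule ccontr)
  assume "\<not> min_distance D \<le> 4"
  then have "5 \<le> hamming_distance u v" if "u \<in> D" "v \<in> D" "u \<noteq> v" for u v
    using min_distance_le[of D n u v] D that by (force simp: linear_code_iff)
  then have "card D * (n * (n - 1) * (CARD('f) - 1)\<^sup>2) \<le> 2 * CARD('f) ^ n"
    using D by (intro sphere_packing) (auto simp: linear_code_iff)
  then have "3 ^ (n - 2 * m) * (4 * (n * (n - 1))) \<le> 2 * 3 ^ n"
    using card_linear_code[OF D(1)] D(2) card by (simp add: mult_ac)
  also have "(3::nat) ^ n = 3 ^ (n - 2 * m) * 3 ^ (2 * m)"
    using le by (simp flip: power_add)
  finally have "4 * (n * (n - 1)) \<le> 2 * 3 ^ (2 * m)"
    by simp
  also have "(3::nat) ^ (2 * m) = (3 ^ m)\<^sup>2"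
    by (simp add: power_mult mult.commute flip: power_mult)
  finally have bound: "2 * (n * (n - 1)) \<le> (3 ^ m)\<^sup>2"
    by simp
  have "(3::nat) ^ 2 \<le> 3 ^ m"
    using m by (intro power_increasing) auto
  then have "3 ^ m = 9 + (3 ^ m - 9 :: nat)"
    by simp
  \<comment> \<open>With \<open>3 ^ m = 9 + k\<close> the bound would read
    \<open>2 * (8 + k) * (7 + k) \<le> (9 + k)\<^sup>2\<close>, which fails for every
    \<open>k\<close>.\<close>
  then obtain k :: nat where k: "3 ^ m = 9 + k"
    by blast
  have "n = 8 + k"
    by (simp add: n_def k)
  then show False
    using bound unfolding k by (simp add: power2_eq_square algebra_simps)
qed

text \<open>On the support of the word, its two zeros become relations with coefficients 1 or -1
  between distinct powers of \<open>\<alpha>\<close>, as positions stay below the order of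
  \<open>\<alpha>\<close>. Weights 1, 2 and 3 are excluded separately.\<close>

lemma (in ternary_field_extension) codeword_weight_ge_4:
  fixes \<alpha> :: 'k and e :: nat
  defines "n \<equiv> 3 ^ m - 1"
  assumes \<alpha>: "primitive_element \<alpha>"
    and m: "odd m" "coprime 3 m" "coprime 13 m"
    and e: "2 * e = 3 ^ ((m + 3) div 2) + 5" "even e"
    and w: "w \<in> carrier_vec n" "eval (word_poly w) \<alpha> = 0" "eval (word_poly w) (\<alpha> ^ e) = 0"
    and nz: "{i. i < n \<and> w $ i \<noteq> 0} \<noteq> {}"
  shows "4 \<le> card {i. i < n \<and> w $ i \<noteq> 0}"
proof -
  define S where "S = {i. i < n \<and> w $ i \<noteq> 0}"
  define c where "c i = \<iota> (w $ i)" for i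
  have c: "c i \<in> {1, - 1}" if "i \<in> S" for i
    using card_3_field_elements(1)[OF card_base, of "w $ i"] that by (auto simp: S_def c_def hom_uminus)
  have sum: "(\<Sum>i\<in>S. c i * x ^ i) = 0" if "eval (word_poly w) x = 0" for x
    using that unfolding eval_word_poly[OF w(1)] S_def c_def
    by (subst sum.mono_neutral_left[of "{..<n}"]) auto
  have sum1: "(\<Sum>i\<in>S. c i * \<alpha> ^ i) = 0"
    by (rule sum[OF w(2)])
  have sume: "(\<Sum>i\<in>S. c i * (\<alpha> ^ i) ^ e) = 0"
    using sum[OF w(3)] by (simp add: mult.commute flip: power_mult)
  have ne: "\<alpha> ^ i \<noteq> \<alpha> ^ j" if "i \<in> S" "j \<in> S" "i \<noteq> j" for i j
    using that unfolding power_primitive_element_eq_iff[OF \<alpha>]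
    by (auto simp: S_def n_def cong_def)
  have "\<alpha> powi 1 \<noteq> 0"
    using \<alpha> unfolding primitive_element_def by blast
  then have \<alpha>0: "\<alpha> ^ i \<noteq> 0" for i
    by simp
  have "card S \<noteq> 0"
    using nz by (simp add: S_def)
  moreover have "card S \<noteq> 1"
  proof
    assume "card S = 1"
    then obtain i where "S = {i}"
      by (rule card_1_singletonE)
    then show False
      using sum1 c[of i] \<alpha>0 by auto
  qed
  moreover have "card S \<noteq> 2"
  proof
    assume "card S = 2"
    then obtain i j where S: "S = {i, j}" "i \<noteq> j"
      by (auto simp: card_2_iff)
    show False
      by (rule no_weight_2_relation[OF three_ext e(2) \<alpha>0 ne[of i j] c[of i] c[of j]])
         (use S sum1 sume in auto)
  qed
  moreover have "card S \<noteq> 3"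
  proof
    assume "card S = 3"
    then obtain i j k where S: "S = {i, j, k}" "i \<noteq> j" "j \<noteq> k" "i \<noteq> k"
      by (auto simp: card_3_iff)
    show False
      by (rule no_weight_3_relation[OF three_ext power_card_ext m e \<alpha>0 \<alpha>0 \<alpha>0
            ne[of i j] ne[of j k] ne[of i k] c[of i] c[of j] c[of k]])
         (use S sum1 sume in \<open>auto simp: add.assoc\<close>)
  qed
  ultimately show ?thesis
    unfolding S_def by linarith
qed

theorem theorem5:
  fixes m :: nat and e :: int
    and \<iota> :: "'f::{field,finite} \<Rightarrow> 'k::{field,finite}" and \<alpha> :: 'k
  assumes "CARD('f) = 3" and "CARD('k) = 3 ^ m" and "field_hom \<iota>"
    and "primitive_element \<alpha>"
    and "m > 0" and "gcd m 6 = 1" and "[m = 3] (mod 4)"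
    and "e = (3 ^ ((m + 3) div 2) + 5) div 2"
    and "\<not> [m = 0] (mod 13)"
  shows "has_parameters (cyclic_code_exps \<iota> \<alpha> [1, e]) (3 ^ m - 1) (3 ^ m - 1 - 2 * m) 4
    \<and> optimal_code (3 ^ m - 1) (cyclic_code_exps \<iota> \<alpha> [1, e])"
proof -
  interpret field_hom \<iota>
    by fact
  interpret ternary_field_extension \<iota> m
    by unfold_locales fact+
  define n :: nat where "n = 3 ^ m - 1"
  define e' :: nat where "e' = (3 ^ ((m + 3) div 2) + 5) div 2"
  define g where "g = minimal_polynomial \<iota> \<alpha> * minimal_polynomial \<iota> (\<alpha> ^ e')"
  define C where "C = {v \<in> carrier_vec n. g dvd word_poly v}"
  note e' = exponent_properties[OF assms(7), folded e'_def]
  have cop: "coprime 2 m" "coprime 3 m"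
  proof -
    have "coprime m (2 * 3)"
      using assms(6) by (simp add: coprime_iff_gcd_eq_1)
    then show "coprime 2 m" "coprime 3 m"
      by (simp_all only: coprime_mult_right_iff coprime_commute)
  qed
  have "\<not> 13 dvd m"
    using assms(9) by (simp add: cong_0_iff)
  then have cop13: "coprime 13 m"
    by (intro prime_imp_coprime) simp_all
  have m3: "m \<ge> 3"
    using assms(7) by (cases "m < 3") (auto simp: cong_def)
  have n: "2 * m < n"
  proof -
    have "2 * k + 1 < 3 ^ k" if "k \<ge> 2" for k :: nat
      using that by (induction k rule: dec_induct) auto
    from this[of m] show ?thesis
      using m3 by (simp add: n_def)
  qed
  have \<alpha>: "\<alpha> ^ 3 ^ k \<noteq> \<alpha>" if "0 < k" "k < m" for k
  proof -
    have "(1::nat) < 3 ^ k" "(3::nat) ^ k * 3 \<le> 3 ^ m"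
      using that one_less_power[of "3::nat" k] power_increasing[of "Suc k" m "3::nat"]
      by (auto simp: mult.commute)
    then have "(3::nat) ^ k < n" "1 < n" "(3::nat) ^ k \<noteq> 1"
      unfolding n_def by linarith+
    then have "\<not> [3 ^ k = 1] (mod n)"
      using cong_less_modulus_unique_nat by blast
    then show ?thesis
      using power_primitive_element_eq_iff[OF assms(4), of "3 ^ k" 1] by (simp add: n_def)
  qed
  have \<beta>: "(\<alpha> ^ e') ^ 3 ^ k \<noteq> \<alpha> ^ e'" if "0 < k" "k < m" for k
    by (rule conjugates_of_power[OF assms(4) cop e'(2) that])
  \<comment> \<open>Parity separates the two orbits: \<open>n\<close> and \<open>e' * 3 ^ j\<close>
    are even, while \<open>3 ^ i\<close> is odd.\<close>
  have \<alpha>\<beta>: "\<alpha> ^ 3 ^ i \<noteq> (\<alpha> ^ e') ^ 3 ^ j" for i j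
  proof
    assume "\<alpha> ^ 3 ^ i = (\<alpha> ^ e') ^ 3 ^ j"
    then have "[3 ^ i = e' * 3 ^ j] (mod n)"
      using power_primitive_element_eq_iff[OF assms(4)] by (simp add: n_def flip: power_mult)
    moreover have "2 dvd n"
      by (simp add: n_def)
    ultimately have "[3 ^ i = e' * 3 ^ j] (mod 2)"
      by (rule cong_dvd_modulus_nat)
    then show False
      using e'(3) by (auto simp: cong_def even_iff_mod_2_eq_zero[symmetric] odd_iff_mod_2_eq_one[symmetric])
  qed
  note dvd_iff = minimal_polynomial_mult_dvd_iff[OF \<alpha> \<beta> \<alpha>\<beta>, folded g_def]
  have monic: "lead_coeff g = 1"
    using minimal_polynomial(1) by (simp add: g_def lead_coeff_mult)
  have "minimal_polynomial \<iota> x \<noteq> 0" for x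
    using minimal_polynomial(1)[of x] by auto
  then have deg: "degree g = 2 * m"
    using degree_minimal_polynomial[OF \<alpha>] degree_minimal_polynomial[OF \<beta>]
    by (simp add: g_def degree_mult_eq)
  have C_eq: "cyclic_code_exps \<iota> \<alpha> [1, e] = C"
  proof -
    have "e = int e'"
      using assms(8) by (simp add: e'_def zdiv_int)
    then have "cyclic_code_exps \<iota> \<alpha> [1, e] = cyclic_code_of n g"
      by (simp add: cyclic_code_exps_def g_def n_def assms(2))
    also have "\<dots> = C"
      unfolding C_def
    proof (rule cyclic_code_of_eq[OF _ _ monic])
      have \<alpha>0: "\<alpha> \<noteq> 0"
        using \<alpha>[of 1] m3 by auto
      \<comment> \<open>By \<open>dvd_iff\<close> it suffices that \<open>\<alpha>\<close> and
        \<open>\<alpha> ^ e'\<close> are zeros of \<open>x ^ n - 1\<close>.\<close>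
      have "x ^ n = 1" if "x \<noteq> 0" for x :: 'k
        using finite_field_power_card_minus_1[OF that] by (simp add: n_def assms(2))
      then show "g dvd monom 1 n - 1"
        using \<alpha>0 by (simp add: dvd_iff eval_monom_minus_1)
    qed (use n in simp)
    finally show ?thesis .
  qed
  have lin: "linear_code n C"
    unfolding C_def by (rule linear_code_multiples)
  have "g \<noteq> 0"
    using monic by auto
  then have "card C = 3 ^ (n - 2 * m)"
    unfolding C_def using card_multiples[of g n] deg n assms(1) by simp
  moreover have "card C = 3 ^ code_dim n C"
    using card_linear_code[OF lin] assms(1) by simp
  ultimately have dim: "code_dim n C = n - 2 * m"
    by (metis one_less_numeral_iff power_inject_exp semiring_norm(77))
  \<comment> \<open>Besides optimality, the case where \<open>D\<close> is \<open>C\<close> gives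
    the upper half of \<open>min_distance C = 4\<close>.\<close>
  have "min_distance D \<le> 4" if "linear_code n D" "code_dim n D = n - 2 * m" for D :: "'f vec set"
    using that n m3 unfolding n_def by (intro min_distance_le_4[OF assms(1)]) auto
  moreover have "4 \<le> min_distance C"
  proof (rule min_distance_ge)
    show "C \<subseteq> carrier_vec n"
      by (auto simp: C_def)
    show "card C > 1"
      using \<open>card C = 3 ^ (n - 2 * m)\<close> n one_less_power[of "3::nat" "n - 2 * m"] by simp
    fix u v
    assume uv: "u \<in> C" "v \<in> C" "u \<noteq> v"
    then have carrier: "u \<in> carrier_vec n" "v \<in> carrier_vec n"
      by (auto simp: C_def)
    have "u + (- 1) \<cdot>\<^sub>v v \<in> C"
      using lin uv by (simp add: linear_code_iff)
    then have w: "u + (- 1) \<cdot>\<^sub>v v \<in> carrier_vec n"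
      "eval (word_poly (u + (- 1) \<cdot>\<^sub>v v)) \<alpha> = 0" "eval (word_poly (u + (- 1) \<cdot>\<^sub>v v)) (\<alpha> ^ e') = 0"
      by (auto simp: C_def dvd_iff)
    have supp: "{i. i < n \<and> (u + (- 1) \<cdot>\<^sub>v v) $ i \<noteq> 0} = {i. i < dim_vec u \<and> u $ i \<noteq> v $ i}"
      using carrier by auto
    have "{i. i < dim_vec u \<and> u $ i \<noteq> v $ i} \<noteq> {}"
      using uv(3) carrier by (auto intro!: eq_vecI)
    then have "4 \<le> card {i. i < n \<and> (u + (- 1) \<cdot>\<^sub>v v) $ i \<noteq> 0}"
      unfolding n_def
      by (intro codeword_weight_ge_4[OF assms(4) e'(1) cop(2) cop13 e'(2,3)] w[unfolded n_def])
         (simp only: supp[unfolded n_def] not_False_eq_True)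
    then show "4 \<le> hamming_distance u v"
      by (simp only: supp hamming_distance_def)
  qed
  ultimately have "min_distance C = 4" "\<And>D :: 'f vec set. linear_code n D \<Longrightarrow> code_dim n D = code_dim n C \<Longrightarrow> min_distance D \<le> min_distance C"
    using lin dim by force+
  then show ?thesis
    unfolding C_eq has_parameters_def optimal_code_def using lin dim by (simp add: n_def)
qed

end
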